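(* Let $f\colon[0,1]\to\mathbb R$ be interval-c.e., and let $z$ be a convergence point for c.e. martingales. Then $f'(z)$ exists.
   Context: A function $f:[0,1]\to\mathbb R$ is interval-c.e. if it is nondecreasing, lower semicontinuous, $f(0)=0$, and $f(y)-f(x)$ is a left-c.e. real uniformly in rationals $x<y$. A martingale is $M:2^{<\omega}\to\mathbb R_{\ge0}$ with $M(\sigma)=(M(\sigma0)+M(\sigma1))/2$; it is left-c.e. (a c.e. martingale) if $M(\sigma)$ is a left-c.e. real uniformly in $\sigma$. A real $z\in[0,1]\setminus\mathbb Q$ with binary expansion $0.Z$ is a convergence point for c.e. martingales if for every left-c.e. martingale $M$, $\lim_n M(Z\upharpoonright n)$ exists and is finite. "$f'(z)$ exists" means the derivative exists and is finite. *)

theory Defs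
  imports "HOL-Analysis.Analysis"
begin

section \<open>Computability\<close>

text \<open>
  The total recursive functions of \<open>n\<close> arguments, arguments being passed as a list of
  length \<open>n\<close>. Minimization is only applied when the search succeeds for all arguments, so
  all functions are total. By the last rule the values on lists of other lengths are irrelevant.
\<close>

inductive total_recursive :: "nat \<Rightarrow> (nat list \<Rightarrow> nat) \<Rightarrow> bool" where
  zero: "total_recursive n (\<lambda>_. 0)"
| succ: "total_recursive 1 (\<lambda>xs. Suc (xs ! 0))"
| proj: "i < n \<Longrightarrow> total_recursive n (\<lambda>xs. xs ! i)"
| comp: "total_recursive (length gs) f \<Longrightarrow> (\<forall>g \<in> set gs. total_recursive n g) \<Longrightarrow>
    total_recursive n (\<lambda>xs. f (map (\<lambda>g. g xs) gs))"
| prim_rec: "total_recursive n f \<Longrightarrow> total_recursive (Suc (Suc n)) g \<Longrightarrow>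
    total_recursive (Suc n)
      (\<lambda>xs. rec_nat (f (tl xs)) (\<lambda>y r. g (y # r # tl xs)) (hd xs))"
| minimize: "total_recursive (Suc n) f \<Longrightarrow>
    (\<forall>xs. length xs = n \<longrightarrow> (\<exists>y. f (y # xs) = 0)) \<Longrightarrow>
    total_recursive n (\<lambda>xs. LEAST y. f (y # xs) = 0)"
| ext: "total_recursive n f \<Longrightarrow> (\<forall>xs. length xs = n \<longrightarrow> f xs = g xs) \<Longrightarrow>
    total_recursive n g"

definition ce :: "nat set \<Rightarrow> bool" where
  "ce A \<longleftrightarrow> A = {} \<or> (\<exists>f. total_recursive 1 f \<and> A = range (\<lambda>n. f [n]))"

text \<open>The rational with code \<open>k\<close>, as a real; every rational has a code, though not a unique one.\<close>

definition rat_of_code :: "nat \<Rightarrow> real" where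
  "rat_of_code k = of_rat (nat_to_rat_surj k)"

text \<open>
  A real is left-c.e. if the set of rationals below it is c.e. For a family \<open>r\<close> this holds
  uniformly if the set of pairs \<open>(i, q)\<close> with \<open>q\<close> rational and \<open>q < r i\<close> is c.e.
  Here \<open>codes n i\<close> means that the number \<open>n\<close> is a code of the index \<open>i\<close>; a number
  should code at most one index, and the family is restricted to the indices that have a code.
\<close>

definition uniformly_left_ce :: "(nat \<Rightarrow> 'i \<Rightarrow> bool) \<Rightarrow> ('i \<Rightarrow> real) \<Rightarrow> bool" where
  "uniformly_left_ce codes r \<longleftrightarrow>
     ce {prod_encode (n, k) | n k. \<exists>i. codes n i \<and> rat_of_code k < r i}"


section \<open>Interval-c.e. functions\<close>

text \<open>
  A function on the unit interval is represented by a function on the reals whose values outside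
  \<open>{0..1}\<close> are never referred to.
\<close>

definition lower_semicontinuous_on :: "real set \<Rightarrow> (real \<Rightarrow> real) \<Rightarrow> bool" where
  "lower_semicontinuous_on S f \<longleftrightarrow>
     (\<forall>x\<in>S. \<forall>a < f x. \<forall>\<^sub>F y in at x within S. a < f y)"

definition codes_unit_rat_pair :: "nat \<Rightarrow> real \<times> real \<Rightarrow> bool" where
  "codes_unit_rat_pair n = (\<lambda>(x, y). \<exists>a b. n = prod_encode (a, b) \<and>
     x = rat_of_code a \<and> y = rat_of_code b \<and> 0 \<le> x \<and> x < y \<and> y \<le> 1)"

definition interval_ce :: "(real \<Rightarrow> real) \<Rightarrow> bool" where
  "interval_ce f \<longleftrightarrow>
     mono_on {0..1} f \<and> lower_semicontinuous_on {0..1} f \<and> f 0 = 0 \<and>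
     uniformly_left_ce codes_unit_rat_pair (\<lambda>(x, y). f y - f x)"


section \<open>Martingales and convergence points\<close>

definition martingale :: "(bool list \<Rightarrow> real) \<Rightarrow> bool" where
  "martingale M \<longleftrightarrow>
     (\<forall>\<sigma>. 0 \<le> M \<sigma>) \<and> (\<forall>\<sigma>. M \<sigma> = (M (\<sigma> @ [False]) + M (\<sigma> @ [True])) / 2)"

text \<open>The code of a binary string \<open>\<sigma>\<close> is the number with binary representation \<open>1\<sigma>\<close>.\<close>

definition string_code :: "bool list \<Rightarrow> nat" where
  "string_code \<sigma> = fold (\<lambda>b n. 2 * n + of_bool b) \<sigma> 1"

definition left_ce_martingale :: "(bool list \<Rightarrow> real) \<Rightarrow> bool" where
  "left_ce_martingale M \<longleftrightarrow>
     martingale M \<and> uniformly_left_ce (\<lambda>n \<sigma>. n = string_code \<sigma>) M"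

definition binary_expansion :: "(nat \<Rightarrow> bool) \<Rightarrow> real \<Rightarrow> bool" where
  "binary_expansion Z z \<longleftrightarrow> (\<lambda>n. of_bool (Z n) / 2 ^ Suc n) sums z"

text \<open>An irrational number in \<open>{0..1}\<close> has exactly one binary expansion.\<close>

definition ce_martingale_convergence_point :: "real \<Rightarrow> bool" where
  "ce_martingale_convergence_point z \<longleftrightarrow>
     z \<in> {0..1} - \<rat> \<and>
     (\<exists>Z. binary_expansion Z z \<and>
          (\<forall>M. left_ce_martingale M \<longrightarrow> convergent (\<lambda>n. M (map Z [0..<n]))))"

end

theory Submission
  imports Defs
begin

text \<open>
  Binary strings are identified with the positive integers that code them, so the children of \<open>n\<close>
  are \<open>2 * n\<close> and \<open>2 * n + 1\<close>. The slopes of \<open>f\<close> over dyadic intervals form a left-c.e. martingale \<open>M\<close>,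
  the limit of a recursive submartingale \<open>a\<close>; let \<open>v\<close> be its limit along \<open>Z\<close>. If \<open>v\<close> is not the derivative
  at \<open>z\<close>, then close to \<open>z\<close>, relative to their length, there are arbitrarily short dyadic intervals
  whose slope is above \<open>p > v\<close> or below \<open>q < v\<close>.

  The capital that \<open>M\<close> has on the dyadic intervals with slope above \<open>p\<close> is again a left-c.e. martingale,
  and its limit along \<open>Z\<close> is \<open>0\<close>, for otherwise \<open>Z\<close> fails a Martin-Loef test. Hence below a long prefix \<open>s\<close>
  of \<open>Z\<close> the intervals with slope above \<open>p\<close> have small measure. Since the average slope below \<open>s\<close> is close
  to \<open>v\<close>, so have those with slope below \<open>q\<close>, even when slopes are replaced by the values of \<open>a\<close>,
  for which being below \<open>q\<close> is decidable. The neighbourhoods of all these intervals still have small measure,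
  so \<open>z\<close> cannot be in them for every \<open>s\<close> without failing a Martin-Loef test.
\<close>

section \<open>Recursive functions\<close>

text \<open>That a slope exceeds \<open>p\<close> is semidecidable, that it is below
  \<open>q\<close> in general is not; so low slopes can only be tested on \<open>a\<close>. But a
  value of \<open>a\<close> may be low merely because \<open>a\<close> still lags behind the
  martingale. Hence low values below \<open>s\<close> count only at depths where the average of
  \<open>a\<close> over \<open>s\<close> has nearly reached \<open>v\<close>, and \<open>a\<close>
  must be a submartingale for this condition to limit the paths on which it drops. Smallness is only
  known for long prefixes of \<open>Z\<close>. The tests are therefore relative: below each string a
  set of proportion at most some constant less than 1, cut off where the proportion would become
  larger, and restarted at each string that enters it. The number of restarts is the capital that
  diverges along a path that enters again and again. Neighbourhoods are needed because a point close
  to \<open>z\<close> may be separated from it by a dyadic point of a much coarser scale, so that no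
  dyadic interval of comparable length contains both. At a scale finer than their distance by a
  constant factor, boundedly many intervals cover the gap, and one of them must deviate.\<close>

named_theorems rec_intros

abbreviation decidable :: "nat \<Rightarrow> (nat list \<Rightarrow> bool) \<Rightarrow> bool" where
  "decidable n P \<equiv> total_recursive n (\<lambda>xs. of_bool (P xs))"

lemma rec_subst:
  assumes "total_recursive m F" "length hs = m" "\<forall>h\<in>set hs. total_recursive n h"
  shows "total_recursive n (\<lambda>xs. F (map (\<lambda>h. h xs) hs))"
  using total_recursive.comp[of hs F n] assms by simp

lemma rec_proj [rec_intros]:
  "i < n \<Longrightarrow> total_recursive n (\<lambda>xs. xs ! i)"
  by (rule total_recursive.proj)

text \<open>Each bounded quantifier or recursion puts a new argument in front, so arguments of outer
  levels appear behind applications of \<open>tl\<close>. Five of them cover the nesting that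
  occurs.\<close>

lemma rec_proj_tl [rec_intros]:
  "Suc i < n \<Longrightarrow> total_recursive n (\<lambda>xs. tl xs ! i)"
  "Suc (Suc i) < n \<Longrightarrow> total_recursive n (\<lambda>xs. tl (tl xs) ! i)"
  "Suc (Suc (Suc i)) < n \<Longrightarrow> total_recursive n (\<lambda>xs. tl (tl (tl xs)) ! i)"
  "Suc (Suc (Suc (Suc i))) < n \<Longrightarrow> total_recursive n (\<lambda>xs. tl (tl (tl (tl xs))) ! i)"
  "Suc (Suc (Suc (Suc (Suc i)))) < n \<Longrightarrow> total_recursive n (\<lambda>xs. tl (tl (tl (tl (tl xs)))) ! i)"
  by (rule total_recursive.ext[OF total_recursive.proj], assumption, simp add: nth_tl)+

lemma rec_comp1:
  assumes "total_recursive 1 (\<lambda>xs. F (xs ! 0))" "total_recursive n f"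
  shows "total_recursive n (\<lambda>xs. F (f xs))"
  using rec_subst[OF assms(1), of "[f]" n] assms(2) by simp

lemma rec_comp2:
  assumes "total_recursive 2 (\<lambda>xs. F (xs ! 0) (xs ! 1))"
    "total_recursive n f" "total_recursive n g"
  shows "total_recursive n (\<lambda>xs. F (f xs) (g xs))"
  using rec_subst[OF assms(1), of "[f, g]" n] assms(2-) by simp

lemma rec_comp3:
  assumes "total_recursive 3 (\<lambda>xs. F (xs ! 0) (xs ! 1) (xs ! 2))"
    "total_recursive n f" "total_recursive n g" "total_recursive n h"
  shows "total_recursive n (\<lambda>xs. F (f xs) (g xs) (h xs))"
  using rec_subst[OF assms(1), of "[f, g, h]" n] assms(2-) by simp

text \<open>Recursion by \<open>prim_rec\<close> runs on the first argument; pushing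
  \<open>h xs\<close> there allows an arbitrary recursive bound while \<open>xs\<close> stays
  available as parameters.\<close>

lemma rec_push:
  assumes "total_recursive (Suc n) F" "total_recursive n h"
  shows "total_recursive n (\<lambda>xs. F (h xs # xs))"
proof -
  let ?hs = "h # map (\<lambda>i xs. xs ! i) [0..<n]"
  have *: "map (\<lambda>h. h xs) ?hs = h xs # xs" if "length xs = n" for xs
    using that by (auto intro!: nth_equalityI simp: nth_Cons')
  have "\<forall>g\<in>set ?hs. total_recursive n g"
    using assms(2) total_recursive.proj[of _ n] by auto
  then have "total_recursive n (\<lambda>xs. F (map (\<lambda>h. h xs) ?hs))"
    by (intro rec_subst[OF assms(1)]) auto
  then show ?thesis
    by (rule total_recursive.ext) (use * in metis)
qed

lemma rec_const [rec_intros]: "total_recursive n (\<lambda>_. c)"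
proof (induction c)
  case (Suc c)
  show ?case using rec_comp1[where F = Suc, OF total_recursive.succ Suc] .
qed (rule total_recursive.zero)

lemma rec_Suc [rec_intros]:
  "total_recursive n f \<Longrightarrow> total_recursive n (\<lambda>xs. Suc (f xs))"
  by (rule rec_comp1[where F = Suc, OF total_recursive.succ])

lemma rec_tl:
  assumes "total_recursive n f"
  shows "total_recursive (Suc n) (\<lambda>xs. f (tl xs))"
proof -
  have "total_recursive (Suc n) (\<lambda>xs. f (map (\<lambda>h. h xs) (map (\<lambda>i xs. xs ! Suc i) [0..<n])))"
    by (rule rec_subst[OF assms]) (auto intro: total_recursive.proj)
  then show ?thesis
  proof (rule total_recursive.ext, intro allI impI)
    fix xs :: "nat list" assume "length xs = Suc n"
    then have "map (\<lambda>h. h xs) (map (\<lambda>i xs. xs ! Suc i) [0..<n]) = tl xs"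
      by (intro nth_equalityI) (auto simp: nth_tl)
    then show "f (map (\<lambda>h. h xs) (map (\<lambda>i xs. xs ! Suc i) [0..<n])) = f (tl xs)" by simp
  qed
qed

lemma rec_rec_nat [rec_intros]:
  assumes "total_recursive n f" "total_recursive (Suc (Suc n)) (\<lambda>ys. b (ys ! 0) (tl ys ! 0) (tl (tl ys)))"
    "total_recursive n h"
  shows "total_recursive n (\<lambda>xs. rec_nat (f xs) (\<lambda>y r. b y r xs) (h xs))"
  using rec_push[OF total_recursive.prim_rec[OF assms(1,2)] assms(3)] by simp

lemma rec_pred: "total_recursive 1 (\<lambda>xs. xs ! 0 - 1)"
proof -
  have "total_recursive 1 (\<lambda>xs. rec_nat 0 (\<lambda>y r. y) (xs ! 0))"
    by (intro rec_intros) auto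
  moreover have "rec_nat 0 (\<lambda>y r. y) m = m - 1" for m by (cases m) auto
  ultimately show ?thesis by simp
qed

lemma rec_add [rec_intros]:
  assumes "total_recursive n f" "total_recursive n g"
  shows "total_recursive n (\<lambda>xs. f xs + g xs)"
proof -
  have "total_recursive n (\<lambda>xs. rec_nat (f xs) (\<lambda>y r. Suc r) (g xs))"
    by (intro rec_intros assms) auto
  moreover have "rec_nat a (\<lambda>y r. Suc r) m = a + m" for a m by (induction m) auto
  ultimately show ?thesis by simp
qed

lemma rec_diff [rec_intros]:
  assumes "total_recursive n f" "total_recursive n g"
  shows "total_recursive n (\<lambda>xs. f xs - g xs)"
proof -
  have "total_recursive n (\<lambda>xs. rec_nat (f xs) (\<lambda>y r. r - 1) (g xs))"
    by (intro rec_intros rec_comp1[OF rec_pred] assms) auto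
  moreover have "rec_nat a (\<lambda>y r. r - 1) m = a - m" for a m :: nat by (induction m) auto
  ultimately show ?thesis by simp
qed

lemma rec_mult [rec_intros]:
  assumes "total_recursive n f" "total_recursive n g"
  shows "total_recursive n (\<lambda>xs. f xs * g xs)"
proof -
  have "total_recursive 2 (\<lambda>xs. rec_nat 0 (\<lambda>y r. r + xs ! 0) (xs ! 1))"
    by (intro rec_intros) auto
  moreover have "rec_nat 0 (\<lambda>y r. r + a) m = a * m" for a m :: nat by (induction m) auto
  ultimately have "total_recursive 2 (\<lambda>xs. xs ! 0 * xs ! 1)" by simp
  then show ?thesis by (rule rec_comp2[OF _ assms])
qed

lemma rec_power [rec_intros]:
  assumes "total_recursive n f" "total_recursive n g"
  shows "total_recursive n (\<lambda>xs. f xs ^ g xs)"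
proof -
  have "total_recursive 2 (\<lambda>xs. rec_nat 1 (\<lambda>y r. r * xs ! 0) (xs ! 1))"
    by (intro rec_intros) auto
  moreover have "rec_nat 1 (\<lambda>y r. r * a) m = a ^ m" for a m :: nat by (induction m) auto
  ultimately have "total_recursive 2 (\<lambda>xs. xs ! 0 ^ xs ! 1)" by simp
  then show ?thesis by (rule rec_comp2[OF _ assms])
qed

lemma rec_le [rec_intros]:
  assumes "total_recursive n f" "total_recursive n g"
  shows "decidable n (\<lambda>xs. f xs \<le> g xs)"
proof -
  have "total_recursive n (\<lambda>xs. 1 - (f xs - g xs))"
    by (intro rec_intros assms)
  moreover have "1 - (a - b) = of_bool (a \<le> b)" for a b :: nat by auto
  ultimately show ?thesis by simp
qed

lemma rec_less [rec_intros]: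
  assumes "total_recursive n f" "total_recursive n g"
  shows "decidable n (\<lambda>xs. f xs < g xs)"
proof -
  have "decidable n (\<lambda>xs. Suc (f xs) \<le> g xs)"
    by (intro rec_intros assms)
  then show ?thesis by (simp add: Suc_le_eq)
qed

lemma rec_conj [rec_intros]:
  assumes "decidable n P" "decidable n Q"
  shows "decidable n (\<lambda>xs. P xs \<and> Q xs)"
proof -
  have "total_recursive n (\<lambda>xs. of_bool (P xs) * of_bool (Q xs))"
    by (intro rec_mult assms)
  then show ?thesis by (simp flip: of_bool_conj)
qed

lemma rec_not [rec_intros]:
  assumes "decidable n P"
  shows "decidable n (\<lambda>xs. \<not> P xs)"
proof -
  have "total_recursive n (\<lambda>xs. 1 - of_bool (P xs))"
    by (intro rec_diff rec_const assms)
  moreover have "1 - of_bool p = (of_bool (\<not> p) :: nat)" for p by auto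
  ultimately show ?thesis by simp
qed

lemma rec_disj [rec_intros]:
  assumes "decidable n P" "decidable n Q"
  shows "decidable n (\<lambda>xs. P xs \<or> Q xs)"
proof -
  have "decidable n (\<lambda>xs. \<not> (\<not> P xs \<and> \<not> Q xs))"
    by (intro rec_not rec_conj assms)
  then show ?thesis by simp
qed

lemma rec_imp [rec_intros]:
  assumes "decidable n P" "decidable n Q"
  shows "decidable n (\<lambda>xs. P xs \<longrightarrow> Q xs)"
proof -
  have "decidable n (\<lambda>xs. \<not> P xs \<or> Q xs)"
    by (intro rec_not rec_disj assms)
  then show ?thesis by (simp only: imp_conv_disj)
qed

lemma rec_eq [rec_intros]:
  assumes "total_recursive n f" "total_recursive n g"
  shows "decidable n (\<lambda>xs. f xs = g xs)"
proof -
  have "decidable n (\<lambda>xs. f xs \<le> g xs \<and> g xs \<le> f xs)"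
    by (intro rec_intros assms)
  then show ?thesis by (simp only: order_eq_iff)
qed

lemma rec_If [rec_intros]:
  assumes "decidable n P" "total_recursive n f" "total_recursive n g"
  shows "total_recursive n (\<lambda>xs. if P xs then f xs else g xs)"
proof -
  have "total_recursive n (\<lambda>xs. of_bool (P xs) * f xs + of_bool (\<not> P xs) * g xs)"
    by (intro rec_add rec_mult rec_not assms)
  moreover have "of_bool p * a + of_bool (\<not> p) * b = (if p then a else b)" for p and a b :: nat
    by auto
  ultimately show ?thesis by simp
qed

lemma rec_sum [rec_intros]:
  assumes "total_recursive (Suc n) (\<lambda>ys. F (ys ! 0) (tl ys))" "total_recursive n h"
  shows "total_recursive n (\<lambda>xs. \<Sum>i<h xs. F i xs)"
proof -
  \<comment> \<open>The step function of the recursion also receives the accumulator, which is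
    projected away before \<open>F\<close> is applied.\<close>
  have 1: "total_recursive (Suc (Suc n)) (\<lambda>ys. F (ys ! 0) (tl (tl ys)))"
  proof -
    have "total_recursive (Suc (Suc n)) (\<lambda>xs. (\<lambda>ys. F (ys ! 0) (tl ys))
       (map (\<lambda>h. h xs) ((\<lambda>xs. xs ! 0) # map (\<lambda>i xs. xs ! Suc (Suc i)) [0..<n])))"
      by (rule rec_subst[OF assms(1)]) (auto intro: total_recursive.proj)
    then show ?thesis
    proof (rule total_recursive.ext, intro allI impI)
      fix xs :: "nat list" assume "length xs = Suc (Suc n)"
      then have "map (\<lambda>i. xs ! Suc (Suc i)) [0..<n] = tl (tl xs)"
        by (intro nth_equalityI) (auto simp: nth_tl)
      then show "(\<lambda>ys. F (ys ! 0) (tl ys)) (map (\<lambda>h. h xs) ((\<lambda>xs. xs ! 0) # map (\<lambda>i xs. xs ! Suc (Suc i)) [0..<n]))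
          = F (xs ! 0) (tl (tl xs))"
        by (simp add: o_def)
    qed
  qed
  have "total_recursive n (\<lambda>xs. rec_nat 0 (\<lambda>i r. r + F i xs) (h xs))"
    by (rule rec_rec_nat) (intro rec_intros 1 assms(2); simp)+
  moreover have "rec_nat 0 (\<lambda>i r. r + G i) m = (\<Sum>i<m. G i)" for G :: "nat \<Rightarrow> nat" and m
    by (induction m) auto
  ultimately show ?thesis by simp
qed

lemma rec_ex_less [rec_intros]:
  assumes "decidable (Suc n) (\<lambda>ys. P (ys ! 0) (tl ys))" "total_recursive n h"
  shows "decidable n (\<lambda>xs. \<exists>i<h xs. P i xs)"
proof -
  have "decidable n (\<lambda>xs. 0 < (\<Sum>i<h xs. of_bool (P i xs) :: nat))"
    by (intro rec_intros assms)
  moreover have "0 < (\<Sum>i<m. of_bool (Q i) :: nat) \<longleftrightarrow> (\<exists>i<m. Q i)" for Q :: "nat \<Rightarrow> bool" and m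
    by (auto simp: zero_less_iff_neq_zero simp del: sum_of_bool_eq)
  ultimately show ?thesis by (simp only:)
qed

lemma rec_all_less [rec_intros]:
  assumes "decidable (Suc n) (\<lambda>ys. P (ys ! 0) (tl ys))" "total_recursive n h"
  shows "decidable n (\<lambda>xs. \<forall>i<h xs. P i xs)"
proof -
  have "decidable n (\<lambda>xs. \<not> (\<exists>i<h xs. \<not> P i xs))"
    by (intro rec_not rec_ex_less assms)
  then show ?thesis by simp
qed

lemma rec_ex_le [rec_intros]:
  assumes "decidable (Suc n) (\<lambda>ys. P (ys ! 0) (tl ys))" "total_recursive n h"
  shows "decidable n (\<lambda>xs. \<exists>i\<le>h xs. P i xs)"
  using rec_ex_less[OF assms(1) rec_Suc[OF assms(2)]] by (simp add: less_Suc_eq_le)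

lemma rec_all_le [rec_intros]:
  assumes "decidable (Suc n) (\<lambda>ys. P (ys ! 0) (tl ys))" "total_recursive n h"
  shows "decidable n (\<lambda>xs. \<forall>i\<le>h xs. P i xs)"
  using rec_all_less[OF assms(1) rec_Suc[OF assms(2)]] by (simp add: less_Suc_eq_le)

lemma rec_Least:
  assumes "decidable (Suc n) (\<lambda>ys. P (ys ! 0) (tl ys))" "\<And>xs. length xs = n \<Longrightarrow> \<exists>y. P y xs"
  shows "total_recursive n (\<lambda>xs. LEAST y. P y xs)"
proof -
  have "total_recursive n (\<lambda>xs. LEAST y. (\<lambda>ys. of_bool (\<not> P (ys ! 0) (tl ys)) :: nat) (y # xs) = 0)"
    by (rule total_recursive.minimize) (use assms in \<open>auto intro: rec_not\<close>)
  then show ?thesis by simp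
qed

lemma rec_div [rec_intros]:
  assumes "total_recursive n f" "total_recursive n g"
  shows "total_recursive n (\<lambda>xs. f xs div g xs)"
proof -
  \<comment> \<open>The disjunct \<open>xs ! 1 = 0\<close> makes the search succeed everywhere and
    returns 0, the value of division by 0.\<close>
  have "total_recursive 2 (\<lambda>xs. LEAST q. xs ! 0 < Suc q * xs ! 1 \<or> xs ! 1 = 0)"
  proof (intro rec_Least rec_intros)
    fix xs :: "nat list"
    show "\<exists>q. xs ! 0 < Suc q * xs ! 1 \<or> xs ! 1 = 0"
      by (cases "xs ! 1") (auto intro!: exI[of _ "xs ! 0"])
  qed auto
  moreover have "(LEAST q. a < Suc q * b \<or> b = 0) = a div b" for a b :: nat
  proof (cases "b = 0")
    case False
    show ?thesis
    proof (rule Least_equality)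
      show "a < Suc (a div b) * b \<or> b = 0"
        using False by (simp add: dividend_less_div_times)
    next
      fix q assume "a < Suc q * b \<or> b = 0"
      then show "a div b \<le> q" using False
        by (metis less_Suc_eq_le less_mult_imp_div_less)
    qed
  qed simp
  ultimately have "total_recursive 2 (\<lambda>xs. xs ! 0 div xs ! 1)" by simp
  then show ?thesis by (rule rec_comp2[OF _ assms])
qed

lemma rec_prod_encode [rec_intros]:
  assumes "total_recursive n f" "total_recursive n g"
  shows "total_recursive n (\<lambda>xs. prod_encode (f xs, g xs))"
  unfolding prod_encode_def triangle_def prod.case by (intro rec_intros assms)

text \<open>Both components are bounded by the code, so each is found by a search whose condition
  quantifies the other one boundedly.\<close>

lemma rec_prod_decode:
  shows rec_fst_prod_decode [rec_intros]:
      "total_recursive n f \<Longrightarrow> total_recursive n (\<lambda>xs. fst (prod_decode (f xs)))"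
    and rec_snd_prod_decode [rec_intros]:
      "total_recursive n f \<Longrightarrow> total_recursive n (\<lambda>xs. snd (prod_decode (f xs)))"
proof -
  have *: "u = prod_encode (fst (prod_decode u), snd (prod_decode u))" for u
    by simp
  have le: "fst (prod_decode u) \<le> u" "snd (prod_decode u) \<le> u" for u
    using le_prod_encode_1[of "fst (prod_decode u)" "snd (prod_decode u)"]
      le_prod_encode_2[of "snd (prod_decode u)" "fst (prod_decode u)"] by simp_all
  have ex: "\<exists>a. \<exists>b\<le>u. prod_encode (a, b) = u" "\<exists>b. \<exists>a\<le>u. prod_encode (a, b) = u" for u
    using le[of u] *[of u] by metis+
  have "total_recursive 1 (\<lambda>xs. LEAST a. \<exists>b\<le>xs ! 0. prod_encode (a, b) = xs ! 0)"
    by (intro rec_Least rec_intros) (simp_all add: ex)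
  moreover have "(LEAST a. \<exists>b\<le>u. prod_encode (a, b) = u) = fst (prod_decode u)" for u
    using le by (intro Least_equality exI[of _ "snd (prod_decode u)"]) auto
  ultimately have 1: "total_recursive 1 (\<lambda>xs. fst (prod_decode (xs ! 0)))" by simp
  have "total_recursive 1 (\<lambda>xs. LEAST b. \<exists>a\<le>xs ! 0. prod_encode (a, b) = xs ! 0)"
    by (intro rec_Least rec_intros) (simp_all add: ex)
  moreover have "(LEAST b. \<exists>a\<le>u. prod_encode (a, b) = u) = snd (prod_decode u)" for u
    using le by (intro Least_equality exI[of _ "fst (prod_decode u)"]) auto
  ultimately have 2: "total_recursive 1 (\<lambda>xs. snd (prod_decode (xs ! 0)))" by simp
  show "total_recursive n f \<Longrightarrow> total_recursive n (\<lambda>xs. fst (prod_decode (f xs)))"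
    by (rule rec_comp1[OF 1])
  show "total_recursive n f \<Longrightarrow> total_recursive n (\<lambda>xs. snd (prod_decode (f xs)))"
    by (rule rec_comp1[OF 2])
qed

text \<open>A nonempty c.e. set must be the range of a total function, so pairs
  \<open>(x, t)\<close> that are not witnesses are sent to a fixed element
  \<open>x0\<close>.\<close>

lemma ce_Collect_ex:
  assumes "decidable 2 (\<lambda>xs. P (xs ! 0) (xs ! 1))"
  shows "ce {x. \<exists>t. P x t}"
proof (cases "\<exists>x t. P x t")
  case True
  then obtain x0 t0 where x0: "P x0 t0" by blast
  define f where "f u = (if P (fst (prod_decode u)) (snd (prod_decode u)) then fst (prod_decode u) else x0)" for u
  note P = rec_comp2[where F = "\<lambda>x y. of_bool (P x y)", OF assms]
  have "total_recursive 1 (\<lambda>xs. f (xs ! 0))"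
    unfolding f_def by (intro rec_If P rec_intros) auto
  moreover have "{x. \<exists>t. P x t} = range f"
  proof (intro equalityI subsetI)
    fix x assume "x \<in> {x. \<exists>t. P x t}"
    then obtain t where "P x t" by blast
    then have "x = f (prod_encode (x, t))" by (simp add: f_def)
    then show "x \<in> range f" by blast
  next
    fix x assume "x \<in> range f"
    then obtain u where "x = f u" by blast
    then show "x \<in> {x. \<exists>t. P x t}"
      using x0 by (cases "P (fst (prod_decode u)) (snd (prod_decode u))") (auto simp: f_def)
  qed
  ultimately show ?thesis
    unfolding ce_def by (intro disjI2 exI[of _ "\<lambda>xs. f (xs ! 0)"]) simp
qed (simp add: ce_def)

section \<open>Martingales as limits of recursive submartingales\<close>

definition lev :: "nat \<Rightarrow> nat" where
  "lev n = (LEAST l. n < 2 ^ Suc l)"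

text \<open>The descendants of \<open>n\<close> exactly \<open>k\<close> levels down, as division by
  2 passes to the parent.\<close>

definition leaves :: "nat \<Rightarrow> nat \<Rightarrow> nat set" where
  "leaves n k = {x. x div 2 ^ k = n}"

text \<open>The conditional expectation at \<open>n\<close> of the value of \<open>b\<close> after
  \<open>k\<close> more random bits.\<close>

definition avg :: "(nat \<Rightarrow> real) \<Rightarrow> nat \<Rightarrow> nat \<Rightarrow> real" where
  "avg b k n = (\<Sum>x\<in>leaves n k. b x) / 2 ^ k"

lemma lev_eqI:
  assumes "2 ^ l \<le> n" "n < 2 ^ Suc l"
  shows "lev n = l"
  unfolding lev_def
proof (rule Least_equality)
  fix m assume "n < 2 ^ Suc m"
  with assms(1) have "(2::nat) ^ l < 2 ^ Suc m" by linarith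
  then show "l \<le> m" by (simp del: power_Suc)
qed (fact assms)

lemma less_lev: "n < 2 ^ Suc (lev n)"
  unfolding lev_def by (rule LeastI[of _ n]) (rule less_trans[OF less_exp], simp)

lemma lev_le:
  assumes "1 \<le> n" shows "2 ^ lev n \<le> n"
proof (cases "lev n")
  case (Suc l)
  then have "\<not> n < 2 ^ Suc l"
    unfolding lev_def by (intro not_less_Least) simp
  then show ?thesis using Suc by simp
qed (use assms in simp)

lemma leaves_altdef: "leaves n k = {n * 2 ^ k..<n * 2 ^ k + 2 ^ k}"
  unfolding leaves_def by (auto simp: div_nat_eqI mult.commute intro: div_times_less_eq_dividend)
    (metis dividend_less_div_times add.commute mult.commute zero_less_numeral zero_less_power)

lemma finite_leaves [simp]: "finite (leaves n k)"
  by (simp add: leaves_altdef)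

lemma card_leaves [simp]: "card (leaves n k) = 2 ^ k"
  by (simp add: leaves_altdef)

lemma leaves_0 [simp]: "leaves n 0 = {n}"
  by (auto simp: leaves_def)

lemma leaves_add: "leaves n (j + k) = (\<Union>m\<in>leaves n j. leaves m k)"
  unfolding leaves_def add.commute[of j] power_add div_mult2_eq by auto

lemma disjoint_leaves: "m \<noteq> n \<Longrightarrow> leaves m k \<inter> leaves n k = {}"
  by (auto simp: leaves_def)

lemma leaves_1: "leaves n (Suc 0) = {2 * n, 2 * n + 1}"
  by (auto simp: leaves_altdef)

lemma leaves_Suc: "leaves n (Suc k) = leaves (2 * n) k \<union> leaves (2 * n + 1) k"
  using leaves_add[of n 1 k] by (simp add: leaves_1)

lemma sum_leaves_add: "(\<Sum>x\<in>leaves n (j + k). f x) = (\<Sum>m\<in>leaves n j. \<Sum>x\<in>leaves m k. f x)"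
  unfolding leaves_add by (intro sum.UNION_disjoint) (auto simp: disjoint_leaves)

lemma sum_leaves_Suc:
  "(\<Sum>x\<in>leaves n (Suc k). f x) = (\<Sum>x\<in>leaves (2 * n) k. f x) + (\<Sum>x\<in>leaves (2 * n + 1) k. f x)"
  using sum_leaves_add[of f n 1 k] by (simp add: leaves_1)

lemma sum_leaves_altdef: "(\<Sum>x\<in>leaves n k. f x) = (\<Sum>i<2 ^ k. f (n * 2 ^ k + i))"
  unfolding leaves_altdef
  using sum.shift_bounds_nat_ivl[of f 0 "n * 2 ^ k" "2 ^ k"]
  by (simp add: add.commute atLeast0LessThan)

lemma leaves_pos: "x \<in> leaves n k \<Longrightarrow> 1 \<le> n \<Longrightarrow> 1 \<le> x"
  by (cases x) (auto simp: leaves_def)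

lemma lev_leaves:
  assumes "x \<in> leaves n k" "1 \<le> n"
  shows "lev x = lev n + k"
proof (rule lev_eqI)
  have x: "n * 2 ^ k \<le> x" "x < Suc n * 2 ^ k" using assms(1) by (auto simp: leaves_altdef)
  have "2 ^ lev n * 2 ^ k \<le> n * (2::nat) ^ k" using lev_le[OF assms(2)] by simp
  with x(1) show "2 ^ (lev n + k) \<le> x" unfolding power_add by linarith
  have "Suc n * 2 ^ k \<le> (2::nat) ^ Suc (lev n) * 2 ^ k"
    using less_lev[of n] by (intro mult_right_mono) auto
  with x(2) show "x < 2 ^ Suc (lev n + k)" by (simp add: power_add)
qed

lemma avg_0 [simp]: "avg b 0 n = b n"
  by (simp add: avg_def)

lemma avg_add: "avg b (j + k) n = avg (avg b k) j n"
  by (simp add: avg_def sum_leaves_add sum_divide_distrib[symmetric] power_add field_simps)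

lemma avg_Suc: "avg b (Suc k) n = (avg b k (2 * n) + avg b k (2 * n + 1)) / 2"
  by (simp add: avg_def sum_leaves_Suc field_simps)

lemma avg_mono:
  assumes "\<And>x. x \<in> leaves n k \<Longrightarrow> b x \<le> c x"
  shows "avg b k n \<le> avg c k n"
  unfolding avg_def by (intro divide_right_mono sum_mono assms) auto

lemma avg_cong:
  "(\<And>x. x \<in> leaves n k \<Longrightarrow> b x = c x) \<Longrightarrow> avg b k n = avg c k n"
  unfolding avg_def by simp

lemma avg_plus: "avg (\<lambda>x. b x + c x) k n = avg b k n + avg c k n"
  by (simp add: avg_def sum.distrib add_divide_distrib)

lemma avg_affine: "avg (\<lambda>x. r + t * b x) k n = r + t * avg b k n"
  by (simp add: avg_def sum.distrib add_divide_distrib sum_distrib_left)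

lemma avg_nonneg: "(\<And>x. 0 \<le> b x) \<Longrightarrow> 0 \<le> avg b k n"
  unfolding avg_def by (simp add: sum_nonneg)

section \<open>Submartingales and the martingales above them\<close>

definition submart :: "(nat \<Rightarrow> real) \<Rightarrow> bool" where
  "submart b \<longleftrightarrow> (\<forall>n\<ge>1. 0 \<le> b n \<and> b n \<le> (b (2 * n) + b (2 * n + 1)) / 2) \<and>
     (\<forall>n\<ge>1. \<exists>C. \<forall>k. avg b k n \<le> C)"

text \<open>The least martingale above \<open>b\<close>: a martingale above \<open>b\<close> is
  above all averages of \<open>b\<close>. The averages increase with \<open>k\<close>, and the
  second clause of \<open>submart\<close> makes their limit finite.\<close>

definition mlim :: "(nat \<Rightarrow> real) \<Rightarrow> nat \<Rightarrow> real" where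
  "mlim b n = lim (\<lambda>k. avg b k n)"

lemma submartD:
  assumes "submart b" "1 \<le> n"
  shows submart_nonneg: "0 \<le> b n" and submart_step: "b n \<le> (b (2 * n) + b (2 * n + 1)) / 2"
  using assms by (auto simp: submart_def)

lemma submart_avg_nonneg:
  assumes "submart b" "1 \<le> n"
  shows "0 \<le> avg b k n"
  unfolding avg_def
  by (intro divide_nonneg_nonneg sum_nonneg submart_nonneg[OF assms(1)] leaves_pos[OF _ assms(2)]) auto

lemma submart_avg_mono:
  assumes "submart b" "1 \<le> n" "j \<le> k"
  shows "avg b j n \<le> avg b k n"
proof -
  have "avg b k n \<le> avg b (Suc k) n" for k
  proof -
    have "avg b k n \<le> avg (avg b 1) k n"
    proof (rule avg_mono)
      fix x assume "x \<in> leaves n k"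
      from submart_step[OF assms(1) leaves_pos[OF this assms(2)]]
      show "b x \<le> avg b 1 x" by (simp add: avg_Suc)
    qed
    then show ?thesis using avg_add[of b k 1 n] by simp
  qed
  then show ?thesis using \<open>j \<le> k\<close> by (rule lift_Suc_mono_le)
qed

lemma submart_mlim:
  assumes "submart b" "1 \<le> n"
  shows "(\<lambda>k. avg b k n) \<longlonglongrightarrow> mlim b n"
proof -
  obtain C where "\<And>k. avg b k n \<le> C"
    using assms unfolding submart_def by blast
  then obtain L where "(\<lambda>k. avg b k n) \<longlonglongrightarrow> L"
    using incseq_convergent[of "\<lambda>k. avg b k n" C] submart_avg_mono[OF assms] by (metis monoI)
  then show ?thesis by (simp add: mlim_def limI)
qed

lemma avg_le_mlim:
  assumes "submart b" "1 \<le> n"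
  shows "avg b k n \<le> mlim b n"
  using submart_avg_mono[OF assms] by (intro incseq_le[OF _ submart_mlim[OF assms]] monoI)

lemma le_mlim: "submart b \<Longrightarrow> 1 \<le> n \<Longrightarrow> b n \<le> mlim b n"
  using avg_le_mlim[of b n 0] by simp

lemma mlim_nonneg: "submart b \<Longrightarrow> 1 \<le> n \<Longrightarrow> 0 \<le> mlim b n"
  using le_mlim submart_nonneg by (blast intro: order_trans)

lemma mlim_double:
  assumes "submart b" "1 \<le> n"
  shows "mlim b n = (mlim b (2 * n) + mlim b (2 * n + 1)) / 2"
proof (rule LIMSEQ_unique)
  show "(\<lambda>k. avg b (Suc k) n) \<longlonglongrightarrow> mlim b n"
    using submart_mlim[OF assms] by (rule LIMSEQ_Suc)
  show "(\<lambda>k. avg b (Suc k) n) \<longlonglongrightarrow> (mlim b (2 * n) + mlim b (2 * n + 1)) / 2"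
    unfolding avg_Suc using assms by (intro tendsto_intros submart_mlim) auto
qed

lemma avg_mlim:
  assumes "submart b" "1 \<le> n"
  shows "avg (mlim b) k n = mlim b n"
  using assms(2)
proof (induction k arbitrary: n)
  case (Suc k)
  then show ?case
    using mlim_double[OF assms(1) Suc.prems] by (simp add: avg_Suc)
qed simp


text \<open>\<open>dyadic B\<close> scales down an integer-valued \<open>B\<close> so that denominators grow with the level.\<close>

definition dyadic :: "(nat \<Rightarrow> nat) \<Rightarrow> nat \<Rightarrow> real" where
  "dyadic B n = real (B n) / 2 ^ lev n"

abbreviation leaf_sum :: "(nat \<Rightarrow> nat) \<Rightarrow> nat \<Rightarrow> nat \<Rightarrow> nat" where
  "leaf_sum B k n \<equiv> \<Sum>i<2 ^ k. B (n * 2 ^ k + i)"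

text \<open>One factor \<open>2 ^ k\<close> of \<open>4 ^ k\<close> counts the leaves, the other
  comes from their denominators. Comparisons of averages with rationals thereby become comparisons
  of natural numbers.\<close>

lemma avg_dyadic:
  assumes "1 \<le> n"
  shows "avg (dyadic B) k n = real (leaf_sum B k n) / real (2 ^ lev n * 4 ^ k)"
proof -
  have "(\<Sum>x\<in>leaves n k. dyadic B x) = (\<Sum>x\<in>leaves n k. real (B x)) / 2 ^ (lev n + k)"
    unfolding sum_divide_distrib
    by (intro sum.cong) (auto simp: dyadic_def lev_leaves[OF _ assms])
  then show ?thesis
    unfolding avg_def by (simp add: sum_leaves_altdef power_add power_mult_distrib[symmetric])
qed

section \<open>Decidable comparisons with coded rationals\<close>

lemma rec_lev [rec_intros]:
  assumes "total_recursive n f"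
  shows "total_recursive n (\<lambda>xs. lev (f xs))"
proof -
  have "total_recursive 1 (\<lambda>xs. LEAST l. xs ! 0 < 2 ^ Suc l)"
    by (intro rec_Least rec_intros) (use less_lev in auto)
  then show ?thesis
    using assms unfolding lev_def by (rule rec_comp1)
qed

lemma int_decode_cases:
  "int_decode n = (if even n then int (Suc n div 2) else - int (Suc n div 2))"
  by (auto simp: int_decode_def sum_decode_def)

text \<open>A code consists of the codes of two integers whose quotient is taken. Even numbers code
  nonnegative integers and odd ones negative integers, so the sign of the quotient is the parity of
  \<open>a + b\<close>, expressed by operations already known to be recursive. If one of the codes
  is 0, the quotient is 0, by convention if it is the denominator.\<close>

lemma rat_of_code_less_iff:
  assumes "0 < w"
  shows "rat_of_code k < real u / real w \<longleftrightarrow>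
    (let a = fst (prod_decode k); b = snd (prod_decode k) in
       if a = 0 \<or> b = 0 then 0 < u
       else (a + b) - 2 * ((a + b) div 2) = 1 \<or> Suc a div 2 * w < u * (Suc b div 2))"
proof -
  obtain a b where ab: "prod_decode k = (a, b)" by force
  define m where "m = Suc a div 2"
  define l where "l = Suc b div 2"
  have dec: "int_decode a = (if even a then int m else - int m)"
    "int_decode b = (if even b then int l else - int l)"
    by (simp_all add: int_decode_cases m_def l_def)
  have rat: "rat_of_code k = of_int (int_decode a) / of_int (int_decode b)"
    by (cases "int_decode b = 0")
      (simp_all add: rat_of_code_def nat_to_rat_surj_def ab of_rat_rat rat_number_collapse)
  show ?thesis
  proof (cases "a = 0 \<or> b = 0")
    case True
    then show ?thesis using assms
      by (auto simp: ab rat int_decode_cases zero_less_divide_iff)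
  next
    case False
    then have pos: "0 < m" "0 < l" by (auto simp: m_def l_def)
    have par: "(a + b) - 2 * ((a + b) div 2) = 1 \<longleftrightarrow> odd (a + b)" by presburger
    show ?thesis
    proof (cases "odd (a + b)")
      case True
      then have "rat_of_code k = - (real m / real l)"
        by (auto simp: rat dec)
      also have "\<dots> < 0" using pos by simp
      also have "0 \<le> real u / real w" by simp
      finally show ?thesis using True False par by (simp add: ab)
    next
      case even: False
      then have "rat_of_code k = real m / real l"
        by (auto simp: rat dec)
      then have "rat_of_code k < real u / real w \<longleftrightarrow> m * w < u * l"
        using pos assms by (simp add: frac_less_eq pos_divide_less_eq divide_less_eq flip: of_nat_mult)
          (simp add: mult.commute less_divide_eq flip: of_nat_mult)
      then show ?thesis using even False par by (simp add: ab m_def l_def)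
    qed
  qed
qed

lemma rec_rat_of_code_less [rec_intros]:
  assumes "total_recursive n k" "total_recursive n u" "total_recursive n w" "\<And>xs. 0 < w xs"
  shows "decidable n (\<lambda>xs. rat_of_code (k xs) < real (u xs) / real (w xs))"
  unfolding rat_of_code_less_iff[OF assms(4)] Let_def if_bool_eq_conj
  by (intro rec_intros assms)


section \<open>String codes, left-c.e. martingales and paths\<close>

lemma string_code_Nil [simp]: "string_code [] = 1"
  by (simp add: string_code_def)

lemma string_code_snoc: "string_code (\<sigma> @ [b]) = 2 * string_code \<sigma> + of_bool b"
  by (simp add: string_code_def)

lemma string_code_pos: "1 \<le> string_code \<sigma>"
  by (induction \<sigma> rule: rev_induct) (auto simp: string_code_snoc)

lemma ex_string_code: "1 \<le> n \<Longrightarrow> \<exists>\<sigma>. n = string_code \<sigma>"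
proof (induction n rule: less_induct)
  case (less n)
  show ?case
  proof (cases "n = 1")
    case True
    then show ?thesis by (intro exI[of _ "[]"]) simp
  next
    case False
    with less.prems have "n div 2 < n" "1 \<le> n div 2" by auto
    then obtain \<sigma> where "n div 2 = string_code \<sigma>" using less.IH by blast
    then have "n = string_code (\<sigma> @ [odd n])"
      by (simp add: string_code_snoc) presburger
    then show ?thesis by blast
  qed
qed

text \<open>The limit is the supremum of the averages, so a finite depth witnesses that it exceeds
  \<open>r\<close>. This makes it left-c.e. if \<open>b\<close> is recursive.\<close>

lemma less_mlim_iff:
  assumes "submart b" "1 \<le> n"
  shows "r < mlim b n \<longleftrightarrow> (\<exists>k. r < avg b k n)"
proof
  assume "r < mlim b n"
  from order_tendstoD(1)[OF submart_mlim[OF assms] this] show "\<exists>k. r < avg b k n"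
    by (auto simp: eventually_sequentially)
qed (use avg_le_mlim[OF assms] in \<open>auto intro: less_le_trans\<close>)

lemma left_ce_martingale_mlim:
  assumes "total_recursive 1 (\<lambda>xs. B (xs ! 0))" "submart (dyadic B)"
  shows "left_ce_martingale (\<lambda>\<sigma>. mlim (dyadic B) (string_code \<sigma>))"
  unfolding left_ce_martingale_def martingale_def uniformly_left_ce_def
proof (intro conjI allI)
  fix \<sigma>
  show "0 \<le> mlim (dyadic B) (string_code \<sigma>)"
    using assms(2) string_code_pos by (rule mlim_nonneg)
  show "mlim (dyadic B) (string_code \<sigma>) =
     (mlim (dyadic B) (string_code (\<sigma> @ [False])) + mlim (dyadic B) (string_code (\<sigma> @ [True]))) / 2"
    using mlim_double[OF assms(2) string_code_pos] by (simp add: string_code_snoc)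
next
  let ?P = "\<lambda>x t. 1 \<le> fst (prod_decode x) \<and> rat_of_code (snd (prod_decode x)) <
    real (leaf_sum B t (fst (prod_decode x))) / real (2 ^ lev (fst (prod_decode x)) * 4 ^ t)"
  have P: "?P (prod_encode (n, k)) t \<longleftrightarrow> 1 \<le> n \<and> rat_of_code k < avg (dyadic B) t n" for n k t
    by (auto simp: avg_dyadic)
  have iff: "(\<exists>\<sigma>. n = string_code \<sigma> \<and> rat_of_code k < mlim (dyadic B) (string_code \<sigma>)) \<longleftrightarrow>
      (\<exists>t. ?P (prod_encode (n, k)) t)" for n k
  proof -
    have "(\<exists>\<sigma>. n = string_code \<sigma> \<and> rat_of_code k < mlim (dyadic B) (string_code \<sigma>)) \<longleftrightarrow>
        1 \<le> n \<and> rat_of_code k < mlim (dyadic B) n"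
      using string_code_pos ex_string_code by auto
    then show ?thesis
      unfolding P using less_mlim_iff[OF assms(2), of n "rat_of_code k"] by blast
  qed
  have *: "{prod_encode (n, k) |n k. R (prod_encode (n, k))} = {x. R x}" for R
  proof (intro equalityI subsetI)
    fix x assume R: "x \<in> {x. R x}"
    obtain n k where "x = prod_encode (n, k)"
      by (metis prod_decode_inverse surj_pair)
    with R show "x \<in> {prod_encode (n, k) |n k. R (prod_encode (n, k))}" by blast
  qed auto
  have "{prod_encode (n, k) |n k. \<exists>\<sigma>. n = string_code \<sigma> \<and>
      rat_of_code k < mlim (dyadic B) (string_code \<sigma>)} = {x. \<exists>t. ?P x t}"
    unfolding iff by (rule *)
  also have "ce \<dots>"
    by (intro ce_Collect_ex rec_intros rec_comp1[where F = B, OF assms(1)]) auto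
  finally show "ce {prod_encode (n, k) |n k.
      \<exists>\<sigma>. n = string_code \<sigma> \<and> rat_of_code k < mlim (dyadic B) (string_code \<sigma>)}" .
qed

definition path_code :: "(nat \<Rightarrow> bool) \<Rightarrow> nat \<Rightarrow> nat" where
  "path_code Z n = string_code (map Z [0..<n])"

lemma path_code_0 [simp]: "path_code Z 0 = 1"
  and path_code_Suc: "path_code Z (Suc n) = 2 * path_code Z n + of_bool (Z n)"
  by (simp_all add: path_code_def string_code_snoc)

lemma path_code_pos: "1 \<le> path_code Z n"
  unfolding path_code_def by (rule string_code_pos)

lemma path_code_leaves: "path_code Z (n + k) \<in> leaves (path_code Z n) k"
proof (induction k)
  case (Suc k)
  then show ?case
    by (auto simp: leaves_def path_code_Suc div_mult2_eq)
qed simp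

lemma lev_path_code: "lev (path_code Z n) = n"
  using lev_leaves[OF path_code_leaves[of Z 0 n]] lev_eqI[of 0 1] by simp

text \<open>Only martingales given by recursive submartingales are ever bet on \<open>Z\<close>, so
  this is all that is used of the assumption on convergence.\<close>

definition convergence_path :: "(nat \<Rightarrow> bool) \<Rightarrow> bool" where
  "convergence_path Z \<longleftrightarrow> (\<forall>B. total_recursive 1 (\<lambda>xs. B (xs ! 0)) \<and> submart (dyadic B) \<longrightarrow>
     convergent (\<lambda>n. mlim (dyadic B) (path_code Z n)))"

lemma convergence_pathI:
  assumes "\<And>M. left_ce_martingale M \<Longrightarrow> convergent (\<lambda>n. M (map Z [0..<n]))"
  shows "convergence_path Z"
  unfolding convergence_path_def path_code_def using assms[OF left_ce_martingale_mlim] by blast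

lemma convergence_pathD:
  assumes "convergence_path Z" "total_recursive 1 (\<lambda>xs. B (xs ! 0))" "submart (dyadic B)"
  shows "convergent (\<lambda>n. mlim (dyadic B) (path_code Z n))"
  using assms unfolding convergence_path_def by blast

section \<open>Martin-Loef tests as martingales\<close>

lemma leaves_child: "x \<in> leaves s k \<Longrightarrow> 2 * x + of_bool b \<in> leaves s (Suc k)"
  by (auto simp: leaves_def div_mult2_eq)

lemma in_leaves_self [simp]: "s \<in> leaves s 0"
  by simp

lemma lev_double: "1 \<le> x \<Longrightarrow> lev (2 * x + of_bool b) = Suc (lev x)"
  using lev_leaves[OF leaves_child[OF in_leaves_self]] by simp

lemma leaves_trans: "x \<in> leaves y k \<Longrightarrow> y \<in> leaves s j \<Longrightarrow> x \<in> leaves s (j + k)"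
  unfolding leaves_add by auto

lemma leaves_div:
  assumes "x \<in> leaves s k" "j \<le> k"
  shows "x div 2 ^ j \<in> leaves s (k - j)"
proof -
  have "k = j + (k - j)" using assms(2) by simp
  then have "x div 2 ^ k = x div 2 ^ j div 2 ^ (k - j)"
    by (metis power_add div_mult2_eq)
  then show ?thesis using assms(1) by (simp add: leaves_def)
qed

lemma leaves_inherit:
  assumes step: "\<And>x k b. x \<in> leaves s k \<Longrightarrow> P x \<Longrightarrow> P (2 * x + of_bool b)"
    and "x \<in> leaves s k" "P x" "y \<in> leaves x j"
  shows "P y"
  using assms(2-)
proof (induction j arbitrary: x k)
  case (Suc j)
  from Suc.prems(3) consider b where "y \<in> leaves (2 * x + of_bool b) j"
    unfolding leaves_Suc by (metis UnE add.right_neutral of_bool_eq(1) of_bool_eq(2))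
  then show ?case
    using Suc.IH[OF leaves_child[OF Suc.prems(1)] step[OF Suc.prems(1,2)]] by cases
qed simp

lemma avg_of_bool: "avg (\<lambda>x. of_bool (P x)) k n = real (card {x \<in> leaves n k. P x}) / 2 ^ k"
  by (simp add: avg_def Int_def)

lemma avg_of_bool_all:
  assumes "\<And>x. x \<in> leaves n k \<Longrightarrow> P x"
  shows "avg (\<lambda>x. of_bool (P x)) k n = 1"
proof -
  have "{x \<in> leaves n k. P x} = leaves n k" using assms by auto
  then show ?thesis by (simp add: avg_of_bool)
qed

text \<open>A walk down the tree remembers its last marked node \<open>s\<close>; a node \<open>x\<close> below \<open>s\<close> is marked
  if \<open>D s x\<close>. If from every node only a proportion \<open>q < 1\<close> of the paths is marked again, then the
  expected number of marks is finite, and it is the limit of a recursive submartingale.\<close>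

locale marking =
  fixes D :: "nat \<Rightarrow> nat \<Rightarrow> bool" and n0 :: nat and q :: real
  assumes dec: "decidable 2 (\<lambda>xs. D (xs ! 0) (xs ! 1))"
    and mono: "\<And>s x k b. 1 \<le> s \<Longrightarrow> x \<in> leaves s k \<Longrightarrow> D s x \<Longrightarrow> D s (2 * x + of_bool b)"
    and q: "0 \<le> q" "q < 1"
    and bound: "\<And>s k. 1 \<le> s \<Longrightarrow> avg (\<lambda>x. of_bool (D s x)) k s \<le> q"
begin

text \<open>The last marked node among the ancestors of \<open>x\<close> of level at most
  \<open>j\<close>; \<open>x div 2 ^ (lev x - i)\<close> is the ancestor of level \<open>i\<close>.
  Up to level \<open>n0\<close> every node is marked by force, so that the walk really starts there;
  \<open>marks\<close> does not count these.\<close>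

definition walk :: "nat \<Rightarrow> nat \<Rightarrow> nat" where
  "walk x j = rec_nat 1 (\<lambda>i s. if Suc i \<le> n0 \<or> D s (x div 2 ^ (lev x - Suc i))
     then x div 2 ^ (lev x - Suc i) else s) j"

definition cur :: "nat \<Rightarrow> nat" where
  "cur x = walk x (lev x)"

definition marks :: "nat \<Rightarrow> nat" where
  "marks x = (\<Sum>j<lev x. of_bool (n0 \<le> j \<and> D (walk x j) (x div 2 ^ (lev x - Suc j))))"

lemma walk_Suc: "walk x (Suc j) = (if Suc j \<le> n0 \<or> D (walk x j) (x div 2 ^ (lev x - Suc j))
     then x div 2 ^ (lev x - Suc j) else walk x j)"
  by (simp add: walk_def)

lemma rec_walk [rec_intros]:
  assumes "total_recursive n f" "total_recursive n g"
  shows "total_recursive n (\<lambda>xs. walk (f xs) (g xs))"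
proof -
  note D = rec_comp2[where F = "\<lambda>x y. of_bool (D x y)", OF dec]
  have "total_recursive 2 (\<lambda>xs. walk (xs ! 0) (xs ! 1))"
    unfolding walk_def by (intro rec_intros D) auto
  then show ?thesis by (rule rec_comp2[OF _ assms])
qed

lemma rec_marks: "total_recursive 1 (\<lambda>xs. marks (xs ! 0))"
proof -
  note D = rec_comp2[where F = "\<lambda>x y. of_bool (D x y)", OF dec]
  show ?thesis
    unfolding marks_def by (intro rec_intros D) auto
qed

text \<open>\<open>walk\<close> runs down from the root to be primitive recursive. The facts of this
  context turn it into recursions from a node to its child.\<close>

context
  fixes x c :: nat and b :: bool
  assumes x: "1 \<le> x" and c: "c = 2 * x + of_bool b"
begin

lemma lev_child: "lev c = Suc (lev x)"
  unfolding c by (rule lev_double[OF x])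

lemma div_child: "j \<le> lev x \<Longrightarrow> c div 2 ^ (lev c - j) = x div 2 ^ (lev x - j)"
proof -
  assume "j \<le> lev x"
  then have "lev c - j = Suc (lev x - j)" by (simp add: lev_child)
  then show ?thesis by (simp add: c div_mult2_eq)
qed

lemma walk_child: "j \<le> lev x \<Longrightarrow> walk c j = walk x j"
proof (induction j)
  case (Suc j)
  then show ?case using div_child[of "Suc j"] by (simp add: walk_Suc)
qed (simp add: walk_def)

lemma cur_child: "cur c = (if lev x < n0 \<or> D (cur x) c then c else cur x)"
  using lev_child by (simp add: cur_def walk_Suc walk_child Suc_le_eq)

lemma marks_child: "marks c = marks x + of_bool (n0 \<le> lev x \<and> D (cur x) c)"
proof -
  have "(\<Sum>j<lev x. of_bool (n0 \<le> j \<and> D (walk c j) (c div 2 ^ (lev c - Suc j)))) = marks x"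
    unfolding marks_def
    by (intro sum.cong refl) (use div_child[of "Suc _"] walk_child in \<open>auto simp: Suc_le_eq\<close>)
  then show ?thesis
    using lev_child walk_child[of "lev x"] by (simp add: marks_def[of c] cur_def)
qed

end

lemma cur_prefix:
  assumes "1 \<le> x"
  shows "1 \<le> cur x \<and> (\<exists>k. x \<in> leaves (cur x) k)"
  using assms
proof (induction x rule: less_induct)
  case (less x)
  show ?case
  proof (cases "x = 1")
    case True
    then have "lev x = 0" using lev_eqI[of 0 1] by simp
    then show ?thesis using True by (auto simp: cur_def walk_def intro: exI[of _ 0])
  next
    case False
    define y where "y = x div 2"
    have y: "1 \<le> y" "y < x" using False less.prems by (auto simp: y_def)
    have x: "x = 2 * y + of_bool (odd x)" by (simp add: y_def)
    from less.IH[OF y(2,1)] obtain k where "1 \<le> cur y" "y \<in> leaves (cur y) k" by blast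
    then show ?thesis
      using cur_child[OF y(1) x] leaves_child[of y "cur y" k "odd x", folded x] less.prems
      by (auto intro: exI[of _ "0::nat"])
  qed
qed

lemma mono_leaves: "1 \<le> s \<Longrightarrow> x \<in> leaves s k \<Longrightarrow> D s x \<Longrightarrow> y \<in> leaves x j \<Longrightarrow> D s y"
  by (rule leaves_inherit[where P = "D s", OF mono])

text \<open>A path that is marked again contributes this mark and then, from the new node, at most
  \<open>q / (1 - q)\<close> further ones in expectation, and
  \<open>1 + q / (1 - q) = 1 / (1 - q)\<close>. The induction needs the probability of the next mark
  in the bound, not just its estimate \<open>q\<close>.\<close>

lemma avg_marks_le:
  assumes "1 \<le> x" "n0 \<le> lev x"
  shows "avg (\<lambda>y. real (marks y)) k x \<le>
    real (marks x) + avg (\<lambda>y. of_bool (D (cur x) y)) k x / (1 - q)"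
  using assms
proof (induction k arbitrary: x)
  case 0
  then show ?case using q by simp
next
  case (Suc k)
  have child: "avg (\<lambda>y. real (marks y)) k c \<le>
      real (marks x) + avg (\<lambda>y. of_bool (D (cur x) y)) k c / (1 - q)"
    if c: "c = 2 * x + of_bool b" for c b
  proof -
    note lev = lev_child[OF Suc.prems(1) c] and cur = cur_child[OF Suc.prems(1) c]
      and marks = marks_child[OF Suc.prems(1) c]
    have c1: "1 \<le> c" using Suc.prems c by simp
    have IH: "avg (\<lambda>y. real (marks y)) k c \<le>
      real (marks c) + avg (\<lambda>y. of_bool (D (cur c) y)) k c / (1 - q)"
      using Suc.IH[OF c1] Suc.prems lev by simp
    show ?thesis
    proof (cases "D (cur x) c")
      case True
      obtain i where i: "1 \<le> cur x" "x \<in> leaves (cur x) i" using cur_prefix[OF Suc.prems(1)] by blast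
      have "c \<in> leaves (cur x) (Suc i)" unfolding c by (rule leaves_child[OF i(2)])
      then have "avg (\<lambda>y. of_bool (D (cur x) y)) k c = 1"
        by (intro avg_of_bool_all mono_leaves[OF i(1) _ True])
      moreover have "avg (\<lambda>y. of_bool (D c y)) k c / (1 - q) \<le> q / (1 - q)"
        using bound[OF c1] q by (intro divide_right_mono) auto
      moreover have "1 + q / (1 - q) = 1 / (1 - q)" using q by (simp add: field_simps)
      ultimately show ?thesis
        using IH True cur marks Suc.prems by simp
    next
      case False
      then show ?thesis using IH cur marks Suc.prems by simp
    qed
  qed
  show ?case
  proof -
    have eq: "(a + b) / 2 / (1 - q) = (a / (1 - q) + b / (1 - q)) / 2" for a b
      by (metis add_divide_distrib divide_divide_eq_left mult.commute)
    have half: "(a + b) / 2 \<le> m + (a' + b') / 2" if "a \<le> m + a'" "b \<le> m + b'" for a b a' b' m :: real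
      using that by argo
    show ?thesis
      unfolding avg_Suc eq
      using child[of "2 * x" False, unfolded of_bool_eq add_0_right, OF refl]
        child[of "2 * x + 1" True, unfolded of_bool_eq, OF refl]
      by (rule half)
  qed
qed

lemma avg_marks_bounded:
  assumes "1 \<le> x"
  shows "avg (\<lambda>y. real (marks y)) k x \<le> real (marks x) + 1 / (1 - q)"
  using assms
proof (induction k arbitrary: x)
  case 0
  then show ?case using q by simp
next
  case (Suc k)
  show ?case
  proof (cases "n0 \<le> lev x")
    case True
    have "avg (\<lambda>y. of_bool (D (cur x) y)) (Suc k) x \<le> avg (\<lambda>y. 1) (Suc k) x"
      by (intro avg_mono) auto
    also have "\<dots> = 1" by (simp add: avg_def)
    finally show ?thesis
      using avg_marks_le[OF Suc.prems True, of "Suc k"] q divide_right_mono[of _ 1 "1 - q"]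
      by (smt (verit, best))
  next
    case False
    then show ?thesis
      using Suc.IH[of "2 * x"] Suc.IH[of "2 * x + 1"] Suc.prems
        marks_child[OF Suc.prems, of "2 * x" False] marks_child[OF Suc.prems, of "2 * x + 1" True]
      by (simp add: avg_Suc)
  qed
qed

lemma dyadic_marks: "dyadic (\<lambda>x. marks x * 2 ^ lev x) = (\<lambda>x. real (marks x))"
  by (auto simp: dyadic_def)

lemma submart_marks: "submart (\<lambda>x. real (marks x))"
  unfolding submart_def
proof (intro conjI allI impI)
  fix n :: nat assume n: "1 \<le> n"
  show "real (marks n) \<le> (real (marks (2 * n)) + real (marks (2 * n + 1))) / 2"
    using marks_child[OF n, of "2 * n" False] marks_child[OF n, of "2 * n + 1" True] by simp
  show "\<exists>C. \<forall>k. avg (\<lambda>x. real (marks x)) k n \<le> C"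
    using avg_marks_bounded[OF n] by blast
qed simp

text \<open>The martingale above \<open>marks\<close> is at least the number of marks, which would
  be unbounded along \<open>Z\<close>.\<close>

lemma not_infinitely_marked:
  assumes "convergence_path Z" "\<And>n. n0 \<le> n \<Longrightarrow> \<exists>m>n. D (path_code Z n) (path_code Z m)"
  shows False
proof -
  let ?p = "path_code Z"
  have "total_recursive 1 (\<lambda>xs. marks (xs ! 0) * 2 ^ lev (xs ! 0))"
    by (intro rec_intros rec_marks) auto
  then have "convergent (\<lambda>n. mlim (\<lambda>x. real (marks x)) (?p n))"
    using convergence_pathD[OF assms(1), of "\<lambda>x. marks x * 2 ^ lev x"] submart_marks
    unfolding dyadic_marks by blast
  then obtain C where C: "mlim (\<lambda>x. real (marks x)) (?p n) \<le> C" for n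
    by (metis Bseq_def convergent_imp_Bseq abs_ge_self order_trans real_norm_def)
  have le_C: "real (marks (?p n)) \<le> C" for n
    using le_mlim[OF submart_marks path_code_pos] C by (rule order_trans)
  \<comment> \<open>The induction goes from one freshly marked prefix to the next, since the
    hypothesis speaks of \<open>D\<close> relative to the prefix \<open>?p n\<close> itself. Taking
    the least \<open>m\<close> ensures that \<open>cur\<close> does not change in between.\<close>
  have "\<exists>n\<ge>n0. cur (?p n) = ?p n \<and> N \<le> marks (?p n)" for N
  proof (induction N)
    case 0
    have "cur (?p n0) = ?p n0"
    proof (cases n0)
      case 0
      have "cur 1 = 1" using lev_eqI[of 0 1] by (simp add: cur_def walk_def)
      then show ?thesis using 0 by (metis path_code_0)
    next
      case (Suc i)
      then show ?thesis
        using cur_child[OF path_code_pos path_code_Suc[of Z i]] by (simp add: lev_path_code)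
    qed
    then show ?case by blast
  next
    case (Suc N)
    then obtain n where n: "n0 \<le> n" "cur (?p n) = ?p n" "N \<le> marks (?p n)" by blast
    define Q where "Q m \<longleftrightarrow> n < m \<and> D (?p n) (?p m)" for m
    define m where "m = (LEAST m. Q m)"
    have m: "Q m" unfolding m_def by (rule LeastI_ex) (use assms(2)[OF n(1)] in \<open>auto simp: Q_def\<close>)
    have min: "\<not> Q j" if "j < m" for j using that unfolding m_def by (rule not_less_Least)
    have cur: "cur (?p (n + i)) = ?p n \<and> N \<le> marks (?p (n + i))" if "n + i < m" for i
      using that
    proof (induction i)
      case (Suc i)
      then show ?case
        using cur_child[OF path_code_pos path_code_Suc[of Z "n + i"]] min[of "Suc (n + i)"]
          marks_child[OF path_code_pos path_code_Suc[of Z "n + i"]] n(1)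
        by (simp add: Q_def lev_path_code)
    qed (use n in simp)
    obtain i where i: "m = Suc (n + i)"
      using m unfolding Q_def by (metis less_iff_Suc_add)
    have "cur (?p m) = ?p m \<and> Suc N \<le> marks (?p m)"
      using cur_child[OF path_code_pos path_code_Suc[of Z "n + i"]] cur[of i] m n(1)
          marks_child[OF path_code_pos path_code_Suc[of Z "n + i"]]
      by (simp add: Q_def i lev_path_code)
    then show ?case using m n(1) by (intro exI[of _ m]) (auto simp: Q_def)
  qed
  then obtain n where "nat \<lceil>C\<rceil> + 1 \<le> marks (?p n)" by blast
  with le_C[of n] show False by linarith
qed

end

text \<open>The enumeration of the marked nodes below \<open>s\<close> is cut off before their proportion
  exceeds \<open>u / w\<close>; for the prefixes of \<open>Z\<close> this does not lose any.\<close>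

lemma convergence_path_test:
  assumes "convergence_path Z" "decidable 2 (\<lambda>xs. D (xs ! 0) (xs ! 1))"
    and mono: "\<And>s x k b. 1 \<le> s \<Longrightarrow> x \<in> leaves s k \<Longrightarrow> D s x \<Longrightarrow> D s (2 * x + of_bool b)"
    and "u < w"
    and small: "\<And>n k. n0 \<le> n \<Longrightarrow> avg (\<lambda>x. of_bool (D (path_code Z n) x)) k (path_code Z n) \<le> real u / real w"
    and hit: "\<And>n. n0 \<le> n \<Longrightarrow> \<exists>m>n. D (path_code Z n) (path_code Z m)"
  shows False
proof -
  define count where "count s k = (\<Sum>i<2 ^ k. of_bool (D s (s * 2 ^ k + i)) :: nat)" for s k
  \<comment> \<open>A node is accepted if some ancestor was in \<open>D s\<close> at a level where
    the proportion was still at most \<open>u / w\<close>. Looking at ancestors keeps acceptance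
    inherited by children even after the cutoff.\<close>
  define D' where "D' s x \<longleftrightarrow> (\<exists>j\<le>lev x. lev s + j \<le> lev x \<and> D s (x div 2 ^ j) \<and>
    count s (lev x - j - lev s) * w \<le> u * 2 ^ (lev x - j - lev s))" for s x
  note D = rec_comp2[where F = "\<lambda>x y. of_bool (D x y)", OF assms(2)]
  have count: "avg (\<lambda>x. of_bool (D s x)) k s = real (count s k) / 2 ^ k" for s k
    unfolding avg_def sum_leaves_altdef count_def by simp
  have w: "0 < w" using \<open>u < w\<close> by simp
  have avg_le_iff: "count s k * w \<le> u * 2 ^ k \<longleftrightarrow> avg (\<lambda>x. of_bool (D s x)) k s \<le> real u / real w" for s k
  proof -
    have "count s k * w \<le> u * 2 ^ k \<longleftrightarrow> real (count s k) * real w \<le> real u * 2 ^ k"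
      by (metis of_nat_le_iff of_nat_mult of_nat_numeral of_nat_power)
    then show ?thesis using w by (simp add: count pos_divide_le_eq pos_le_divide_eq field_simps)
  qed
  have D'_iff: "D' s x \<longleftrightarrow> (\<exists>j\<le>k. D s (x div 2 ^ j) \<and>
      avg (\<lambda>x. of_bool (D s x)) (k - j) s \<le> real u / real w)"
    if "1 \<le> s" "x \<in> leaves s k" for s x k
    unfolding D'_def avg_le_iff lev_leaves[OF that(2,1)] by simp (meson trans_le_add2)
  have mono': "D s y" if "1 \<le> s" "x \<in> leaves s k" "D s x" "y \<in> leaves x j" for s x y k j
    using leaves_inherit[where P = "D s", OF mono[OF that(1)] that(2-)] .
  interpret marking D' n0 "real u / real w"
  proof
    show "decidable 2 (\<lambda>xs. D' (xs ! 0) (xs ! 1))"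
      unfolding D'_def count_def by (intro rec_intros D) auto
  next
    fix s x k b assume *: "1 \<le> s" "x \<in> leaves s k" "D' s x"
    let ?c = "2 * x + of_bool b"
    from * D'_iff obtain j where "j \<le> k" "D s (x div 2 ^ j)"
      "avg (\<lambda>x. of_bool (D s x)) (k - j) s \<le> real u / real w" by blast
    moreover have "?c div 2 ^ Suc j = x div 2 ^ j" by (simp add: div_mult2_eq)
    ultimately show "D' s (2 * x + of_bool b)"
      using D'_iff[OF *(1) leaves_child[OF *(2), of b]] by (metis Suc_le_mono diff_Suc_Suc)
  next
    show "0 \<le> real u / real w" "real u / real w < 1" using \<open>u < w\<close> by auto
  next
    fix s k :: nat assume s: "1 \<le> s"
    let ?ok = "\<lambda>m. avg (\<lambda>x. of_bool (D s x)) m s \<le> real u / real w"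
    show "avg (\<lambda>x. of_bool (D' s x)) k s \<le> real u / real w"
    proof (cases "\<exists>m\<le>k. ?ok m")
      case False
      then have "{x \<in> leaves s k. D' s x} = {}"
        using D'_iff[OF s] diff_le_self by blast
      then show ?thesis unfolding avg_of_bool by (simp only: card.empty) simp
    next
      case True
      \<comment> \<open>The last level up to \<open>k\<close> at which the proportion is within the
        bound: \<open>D'\<close> accepts at level \<open>k\<close> only descendants of nodes of
        level \<open>K\<close> in \<open>D s\<close>.\<close>
      define K where "K = Max {m. m \<le> k \<and> ?ok m}"
      have fin: "finite {m. m \<le> k \<and> ?ok m}" by simp
      have K: "K \<le> k" "?ok K"
        using Max_in[OF fin] True unfolding K_def by blast+
      have max: "m \<le> K" if "m \<le> k" "?ok m" for m
        using Max_ge[OF fin] that unfolding K_def by blast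
      have k: "k = K + (k - K)" using K by simp
      have "avg (\<lambda>x. of_bool (D' s x)) k s \<le> avg (\<lambda>x. of_bool (D s (x div 2 ^ (k - K)))) k s"
      proof (rule avg_mono)
        fix x assume x: "x \<in> leaves s k"
        show "of_bool (D' s x) \<le> (of_bool (D s (x div 2 ^ (k - K))) :: real)"
        proof (cases "D' s x")
          case True
          then obtain j where j: "j \<le> k" "D s (x div 2 ^ j)" "?ok (k - j)"
            using D'_iff[OF s x] by blast
          have "k - j \<le> K" using j by (intro max) auto
          then have "j = (k - K) + (K - (k - j))" using j(1) K(1) by linarith
          then have "x div 2 ^ j = x div 2 ^ (k - K) div 2 ^ (K - (k - j))"
            by (metis power_add div_mult2_eq)
          then have "x div 2 ^ (k - K) \<in> leaves (x div 2 ^ j) (K - (k - j))"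
            by (simp add: leaves_def)
          then have "D s (x div 2 ^ (k - K))"
            using mono'[OF s leaves_div[OF x j(1)] j(2)] by blast
          then show ?thesis by simp
        qed simp
      qed
      also have "\<dots> = avg (avg (\<lambda>x. of_bool (D s (x div 2 ^ (k - K)))) (k - K)) K s"
        by (subst k, subst avg_add) simp
      also have "\<dots> \<le> avg (\<lambda>x. of_bool (D s x)) K s"
      proof (rule avg_mono)
        fix y
        have "avg (\<lambda>x. of_bool (D s (x div 2 ^ (k - K)))) (k - K) y = avg (\<lambda>x. of_bool (D s y)) (k - K) y"
          unfolding avg_def by (intro arg_cong2[of _ _ _ _ "(/)"] sum.cong) (auto simp: leaves_def)
        also have "\<dots> = of_bool (D s y)" by (simp add: avg_def)
        finally show "avg (\<lambda>x. of_bool (D s (x div 2 ^ (k - K)))) (k - K) y \<le> of_bool (D s y)"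
          by simp
      qed
      finally show ?thesis using K(2) by simp
    qed
  qed
  have "\<exists>m>n. D' (path_code Z n) (path_code Z m)" if "n0 \<le> n" for n
  proof -
    from hit[OF that] obtain m where m: "m > n" "D (path_code Z n) (path_code Z m)" by blast
    have "path_code Z m \<in> leaves (path_code Z n) (m - n)"
      using path_code_leaves[of Z n "m - n"] m by simp
    from D'_iff[OF path_code_pos this] m small[OF that] have "D' (path_code Z n) (path_code Z m)"
      by (auto intro!: exI[of _ 0])
    with m show ?thesis by blast
  qed
  with \<open>convergence_path Z\<close> show False by (rule not_infinitely_marked)
qed

section \<open>Slopes that deviate from the limit\<close>

text \<open>The cutoff has to be decidable, so \<open>q\<close> is replaced by a rational strictly
  between \<open>q\<close> and 1.\<close>

lemma convergence_path_test_real: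
  assumes "convergence_path Z" "decidable 2 (\<lambda>xs. D (xs ! 0) (xs ! 1))"
    and mono: "\<And>s x k b. 1 \<le> s \<Longrightarrow> x \<in> leaves s k \<Longrightarrow> D s x \<Longrightarrow> D s (2 * x + of_bool b)"
    and "q < 1"
    and small: "\<And>n k. n0 \<le> n \<Longrightarrow> avg (\<lambda>x. of_bool (D (path_code Z n) x)) k (path_code Z n) \<le> q"
    and hit: "\<And>n. n0 \<le> n \<Longrightarrow> \<exists>m>n. D (path_code Z n) (path_code Z m)"
  shows False
proof -
  have "0 \<le> q"
    by (rule order_trans[OF avg_nonneg small[of n0 0]]) auto
  obtain r where r: "r \<in> \<rat>" "q < r" "r < 1"
    using Rats_dense_in_real[OF \<open>q < 1\<close>] by blast
  obtain u w :: nat where uw: "w \<noteq> 0" "\<bar>r\<bar> = real u / real w"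
    using Rats_abs_nat_div_natE[OF r(1)] by metis
  with r \<open>0 \<le> q\<close> have "r = real u / real w" "u < w" by (auto simp: divide_less_eq)
  with r small have "avg (\<lambda>x. of_bool (D (path_code Z n) x)) k (path_code Z n) \<le> real u / real w"
    if "n0 \<le> n" for n k using that by (metis less_imp_le order_trans)
  from convergence_path_test[OF assms(1,2) mono \<open>u < w\<close> this hit] show False .
qed

text \<open>After clearing denominators by \<open>avg_dyadic\<close> only natural numbers are
  compared. That formula is for positive nodes, hence the conjunct \<open>1 \<le> y xs\<close>,
  which recurs wherever decidability is shown.\<close>

lemma rec_avg_compare:
  assumes "r \<in> \<rat>" "0 \<le> r" "total_recursive 1 (\<lambda>xs. A (xs ! 0))"
    "total_recursive n k" "total_recursive n y"
  shows rec_less_avg: "decidable n (\<lambda>xs. 1 \<le> y xs \<and> r < avg (dyadic A) (k xs) (y xs))"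
    and rec_le_avg: "decidable n (\<lambda>xs. 1 \<le> y xs \<and> r \<le> avg (dyadic A) (k xs) (y xs))"
proof -
  obtain u w :: nat where uw: "w \<noteq> 0" "\<bar>r\<bar> = real u / real w"
    using Rats_abs_nat_div_natE[OF assms(1)] by metis
  with assms(2) have r: "r = real u / real w" by simp
  note A = rec_comp1[where F = A, OF assms(3)]
  have less: "r < real l / real d \<longleftrightarrow> u * d < l * w" and le: "r \<le> real l / real d \<longleftrightarrow> u * d \<le> l * w"
    if "0 < d" for l d :: nat
    using that uw(1)
    by (simp_all add: r pos_less_divide_eq pos_le_divide_eq pos_divide_less_eq pos_divide_le_eq
        mult.commute flip: of_nat_mult)
  have 1: "1 \<le> m \<and> r < avg (dyadic A) i m \<longleftrightarrow> 1 \<le> m \<and> u * (2 ^ lev m * 4 ^ i) < leaf_sum A i m * w"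
   and 2: "1 \<le> m \<and> r \<le> avg (dyadic A) i m \<longleftrightarrow> 1 \<le> m \<and> u * (2 ^ lev m * 4 ^ i) \<le> leaf_sum A i m * w"
    for m i
    by (rule conj_cong[OF refl], subst avg_dyadic, simp, rule less le, simp)+
  show "decidable n (\<lambda>xs. 1 \<le> y xs \<and> r < avg (dyadic A) (k xs) (y xs))"
    unfolding 1 by (intro rec_intros A rec_tl[OF assms(4)] rec_tl[OF assms(5)] assms(4,5)) auto
  show "decidable n (\<lambda>xs. 1 \<le> y xs \<and> r \<le> avg (dyadic A) (k xs) (y xs))"
    unfolding 2 by (intro rec_intros A rec_tl[OF assms(4)] rec_tl[OF assms(5)] assms(4,5)) auto
qed

lemma path_code_div: "j \<le> n \<Longrightarrow> path_code Z n div 2 ^ j = path_code Z (n - j)"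
  using path_code_leaves[of Z "n - j" j] by (simp add: leaves_def)

lemma child_div: "(2 * x + of_bool b) div 2 ^ Suc j = (x :: nat) div 2 ^ j"
  by (simp add: div_mult2_eq)

section \<open>The capital on intervals of large slope\<close>

locale density_path =
  fixes A :: "nat \<Rightarrow> nat" and Z :: "nat \<Rightarrow> bool" and v p :: real and n0 :: nat
  assumes rec_A: "total_recursive 1 (\<lambda>xs. A (xs ! 0))"
    and submart_a: "submart (dyadic A)"
    and Z: "convergence_path Z"
    and v: "(\<lambda>n. mlim (dyadic A) (path_code Z n)) \<longlonglongrightarrow> v"
    and p: "p \<in> \<rat>" "v < p"
    and n0: "\<And>n. n0 \<le> n \<Longrightarrow> mlim (dyadic A) (path_code Z n) < p"
begin

abbreviation a :: "nat \<Rightarrow> real" where "a \<equiv> dyadic A"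
abbreviation M :: "nat \<Rightarrow> real" where "M \<equiv> mlim a"

lemma v_nonneg: "0 \<le> v"
  using v by (rule LIMSEQ_le_const) (auto intro: mlim_nonneg submart_a path_code_pos)

lemma p_pos: "0 < p"
  using v_nonneg p by simp

text \<open>The values of \<open>a\<close> at the level of \<open>x\<close> itself already prove
  that \<open>M\<close> exceeds \<open>p\<close> at an ancestor. This is decidable, and inherited by
  descendants because the averages of \<open>a\<close> increase with the depth.\<close>

definition hit :: "nat \<Rightarrow> bool" where
  "hit x \<longleftrightarrow> (\<exists>j\<le>lev x. n0 \<le> lev x - j \<and> 1 \<le> x div 2 ^ j \<and> p < avg a j (x div 2 ^ j))"

lemma rec_hit:
  assumes "total_recursive n f"
  shows "decidable n (\<lambda>xs. hit (f xs))"
proof -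
  have "decidable 1 (\<lambda>xs. hit (xs ! 0))"
    unfolding hit_def by (intro rec_intros rec_less_avg rec_A p less_imp_le[OF p_pos]) auto
  then show ?thesis using assms by (rule rec_comp1)
qed

lemma hitI:
  assumes "1 \<le> s" "x \<in> leaves s k" "n0 \<le> lev s" "p < avg a k s"
  shows "hit x"
  unfolding hit_def
  using assms lev_leaves[OF assms(2,1)] by (intro exI[of _ k]) (auto simp: leaves_def)

lemma hit_child:
  assumes "1 \<le> x" "hit x"
  shows "hit (2 * x + of_bool b)"
proof -
  from assms obtain j where j: "j \<le> lev x" "n0 \<le> lev x - j" "1 \<le> x div 2 ^ j" "p < avg a j (x div 2 ^ j)"
    by (auto simp: hit_def)
  have "avg a j (x div 2 ^ j) \<le> avg a (Suc j) (x div 2 ^ j)"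
    using submart_a j(3) by (rule submart_avg_mono) simp
  moreover have "lev (2 * x + of_bool b) = Suc (lev x)"
    using assms(1) by (rule lev_double)
  ultimately show ?thesis
    using j unfolding hit_def by (intro exI[of _ "Suc j"]) (simp only: child_div, auto)
qed

lemma not_hit_path: "\<not> hit (path_code Z n)"
proof
  assume "hit (path_code Z n)"
  then obtain j where j: "j \<le> n" "n0 \<le> n - j" "p < avg a j (path_code Z (n - j))"
    by (auto simp: hit_def lev_path_code path_code_div)
  with n0[OF j(2)] avg_le_mlim[OF submart_a path_code_pos, of j Z "n - j"] show False by simp
qed

definition Ahit :: "nat \<Rightarrow> nat" where
  "Ahit x = (if hit x then A x else 0)"

abbreviation ahit :: "nat \<Rightarrow> real" where "ahit \<equiv> dyadic Ahit"
abbreviation Mhit :: "nat \<Rightarrow> real" where "Mhit \<equiv> mlim ahit"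

lemma ahit_altdef: "ahit x = (if hit x then a x else 0)"
  by (simp add: dyadic_def Ahit_def)

lemma rec_Ahit: "total_recursive 1 (\<lambda>xs. Ahit (xs ! 0))"
  unfolding Ahit_def by (intro rec_If rec_hit rec_A rec_const rec_proj) auto

lemma a_nonneg: "0 \<le> a x"
  by (simp add: dyadic_def)

text \<open>Hits are inherited and \<open>a\<close> is nonnegative, so setting \<open>a\<close> to 0
  off the hit nodes keeps the inequality from parent to children.\<close>

lemma submart_ahit: "submart ahit"
  unfolding submart_def
proof (intro conjI allI impI)
  fix n :: nat assume n: "1 \<le> n"
  show "0 \<le> ahit n" by (simp add: dyadic_def)
  have "0 \<le> ahit (2 * n)" "0 \<le> ahit (2 * n + 1)" by (simp_all add: dyadic_def)
  then show "ahit n \<le> (ahit (2 * n) + ahit (2 * n + 1)) / 2"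
    using hit_child[OF n, of False] hit_child[OF n, of True] submart_step[OF submart_a n]
    by (auto simp: ahit_altdef a_nonneg)
  have "avg ahit k n \<le> M n" for k
  proof -
    have "avg ahit k n \<le> avg a k n"
      by (intro avg_mono) (simp add: ahit_altdef a_nonneg)
    then show ?thesis using avg_le_mlim[OF submart_a n] by (rule order_trans)
  qed
  then show "\<exists>C. \<forall>k. avg ahit k n \<le> C" by blast
qed

text \<open>If the limit were \<open>l > 0\<close>, then below a prefix \<open>s\<close> of \<open>Z\<close> one can wait until an amount close
  to \<open>l\<close> of the capital has moved to nodes which \<open>Z\<close> avoids; what remains is less than \<open>v\<close>, so that
  few of the remaining paths can reach a capital close to \<open>v\<close> as \<open>Z\<close> does.\<close>

lemma Mhit_tendsto_0: "(\<lambda>n. Mhit (path_code Z n)) \<longlonglongrightarrow> 0"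
proof -
  let ?p = "path_code Z"
  obtain l where l: "(\<lambda>n. Mhit (?p n)) \<longlonglongrightarrow> l"
    using convergence_pathD[OF Z rec_Ahit submart_ahit] by (auto simp: convergent_def)
  have "0 \<le> l"
    using l by (rule LIMSEQ_le_const) (auto intro: mlim_nonneg submart_ahit path_code_pos)
  have ahit_le: "ahit x \<le> M x" if "1 \<le> x" for x
    using le_mlim[OF submart_a that] mlim_nonneg[OF submart_a that] by (simp add: ahit_altdef)
  have Mhit_le: "Mhit x \<le> M x" if "1 \<le> x" for x
  proof (rule LIMSEQ_le_const2[OF submart_mlim[OF submart_ahit that]], intro exI allI impI)
    fix k
    have "avg ahit k x \<le> avg M k x"
      by (rule avg_mono) (rule ahit_le[OF leaves_pos[OF _ that]])
    then show "avg ahit k x \<le> M x" by (simp add: avg_mlim[OF submart_a that])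
  qed
  have "l \<le> v"
    using l v by (rule LIMSEQ_le) (use Mhit_le path_code_pos in blast)
  have "\<not> 0 < l"
  proof
    assume "0 < l"
    \<comment> \<open>The constants give \<open>v + l / 4 - d < v - l / 2 < c\<close>: what is left
      after capital \<open>d\<close> has moved to hit nodes does not suffice to reach
      \<open>c\<close> on all paths.\<close>
    obtain d where d: "d \<in> \<rat>" "3 * l / 4 < d" "d < l"
      using Rats_dense_in_real[of "3 * l / 4" l] \<open>0 < l\<close> by auto
    obtain c where c: "c \<in> \<rat>" "v - l / 4 < c" "c < v"
      using Rats_dense_in_real[of "v - l / 4" v] \<open>0 < l\<close> by auto
    have pos: "0 < d" "0 < c" using d c \<open>0 < l\<close> \<open>l \<le> v\<close> by auto
    have "\<forall>\<^sub>F n in sequentially. c < M (?p n) \<and> M (?p n) < v + l / 4 \<and> d < Mhit (?p n)"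
      using order_tendstoD(1)[OF v c(3)] order_tendstoD(2)[OF v, of "v + l / 4"]
        order_tendstoD(1)[OF l d(3)] \<open>0 < l\<close> by (auto simp: eventually_conj_iff)
    then obtain n1 where n1: "\<And>n. n1 \<le> n \<Longrightarrow> c < M (?p n)"
        "\<And>n. n1 \<le> n \<Longrightarrow> M (?p n) < v + l / 4" "\<And>n. n1 \<le> n \<Longrightarrow> d < Mhit (?p n)"
      by (auto simp: eventually_sequentially)
    \<comment> \<open>\<open>S s k\<close> says that \<open>k\<close> is the first depth at which
      hit nodes carry more than \<open>d\<close>. Its uniqueness fixes one level at which the nodes
      that are not hit are collected, so their proportion is estimated only once.\<close>
    define S where "S s k \<longleftrightarrow> (1 \<le> s \<and> d < avg ahit k s) \<and> (\<forall>i<k. \<not> (1 \<le> s \<and> d < avg ahit i s))" for s k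
    define D where "D s x \<longleftrightarrow> (\<exists>j\<le>lev x. lev s + j \<le> lev x \<and> S s (lev x - j - lev s) \<and>
      \<not> hit (x div 2 ^ j) \<and> 1 \<le> x div 2 ^ j \<and> c < avg a j (x div 2 ^ j))" for s x
    have D_iff: "D s x \<longleftrightarrow> (\<exists>j\<le>k. S s (k - j) \<and> \<not> hit (x div 2 ^ j) \<and> c < avg a j (x div 2 ^ j))"
      if "1 \<le> s" "x \<in> leaves s k" for s x k
    proof -
      have "1 \<le> x div 2 ^ j" if "j \<le> k" for j
        using leaves_pos[OF leaves_div[OF \<open>x \<in> leaves s k\<close> that] \<open>1 \<le> s\<close>] .
      then show ?thesis
        unfolding D_def lev_leaves[OF that(2,1)] by simp (meson trans_le_add2)
    qed
    have S_unique: "S s k \<Longrightarrow> S s k' \<Longrightarrow> k = k'" for s k k'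
      unfolding S_def by (metis linorder_neqE_nat)
    show False
    proof (rule convergence_path_test_real[OF Z])
      show "decidable 2 (\<lambda>xs. D (xs ! 0) (xs ! 1))"
        unfolding D_def S_def
        by (intro rec_intros rec_hit rec_less_avg rec_A rec_Ahit c d less_imp_le[OF pos(1)] less_imp_le[OF pos(2)]) auto
    next
      fix s x k b assume *: "1 \<le> s" "x \<in> leaves s k" "D s x"
      then obtain j where j: "j \<le> k" "S s (k - j)" "\<not> hit (x div 2 ^ j)" "c < avg a j (x div 2 ^ j)"
        using D_iff by blast
      have "1 \<le> x div 2 ^ j" using leaves_pos[OF leaves_div[OF *(2) j(1)] *(1)] .
      then have "avg a j (x div 2 ^ j) \<le> avg a (Suc j) (x div 2 ^ j)"
        by (intro submart_avg_mono[OF submart_a]) auto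
      with j show "D s (2 * x + of_bool b)"
        unfolding D_iff[OF *(1) leaves_child[OF *(2)]]
        by (intro exI[of _ "Suc j"]) (simp only: child_div, auto)
    next
      show "(v + l / 4 - d) / c < 1"
        using pos c d by (simp add: divide_less_eq)
    next
      fix n k assume n: "n1 \<le> n"
      let ?s = "?p n"
      have s: "1 \<le> ?s" by (rule path_code_pos)
      show "avg (\<lambda>x. of_bool (D ?s x)) k ?s \<le> (v + l / 4 - d) / c"
      proof (cases "\<exists>k0\<le>k. S ?s k0")
        case False
        then have "avg (\<lambda>x. of_bool (D ?s x)) k ?s = avg (\<lambda>x. 0) k ?s"
          by (intro avg_cong) (use D_iff[OF s] diff_le_self in auto)
        also have "\<dots> = 0" by (simp add: avg_def)
        also have "0 \<le> (v + l / 4 - d) / c"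
          using pos d \<open>l \<le> v\<close> \<open>0 < l\<close> by simp
        finally show ?thesis .
      next
        case True
        then obtain k0 where k0: "k0 \<le> k" "S ?s k0" by blast
        define j where "j = k - k0"
        have k: "k = k0 + j" using k0 by (simp add: j_def)
        have "avg (\<lambda>x. of_bool (D ?s x)) k ?s = avg (avg (\<lambda>x. of_bool (D ?s x)) j) k0 ?s"
          unfolding k by (rule avg_add)
        \<comment> \<open>Markov's inequality for \<open>M - ahit\<close>, which equals
          \<open>M\<close> on nodes that are not hit and is nonnegative on the others.\<close>
        also have "\<dots> \<le> avg (\<lambda>y. (M y - ahit y) / c) k0 ?s"
        proof (rule avg_mono)
          fix y assume y: "y \<in> leaves ?s k0"
          then have y1: "1 \<le> y" using s by (rule leaves_pos)
          have "avg (\<lambda>x. of_bool (D ?s x)) j y \<le> avg (\<lambda>x. of_bool (\<not> hit y \<and> c < avg a j y)) j y"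
          proof (rule avg_mono)
            fix x assume x: "x \<in> leaves y j"
            have "D ?s x \<Longrightarrow> \<not> hit y \<and> c < avg a j y"
            proof -
              assume "D ?s x"
              then obtain i where i: "i \<le> k" "S ?s (k - i)" "\<not> hit (x div 2 ^ i)" "c < avg a i (x div 2 ^ i)"
                using D_iff[OF s leaves_trans[OF x y]] unfolding k by blast
              have "i = j" using S_unique[OF i(2) k0(2)] i(1) k by simp
              with i x show ?thesis by (simp add: leaves_def)
            qed
            then show "of_bool (D ?s x) \<le> (of_bool (\<not> hit y \<and> c < avg a j y) :: real)" by simp
          qed
          also have "\<dots> = of_bool (\<not> hit y \<and> c < avg a j y)" by (simp add: avg_def)
          also have "\<dots> \<le> (M y - ahit y) / c"
          proof (cases "\<not> hit y \<and> c < avg a j y")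
            case True
            then have "c \<le> M y" using avg_le_mlim[OF submart_a y1, of j] by simp
            with True show ?thesis using pos by (simp add: ahit_altdef)
          next
            case False
            then have *: "of_bool (\<not> hit y \<and> c < avg a j y) = (0 :: real)" by (simp only: of_bool_eq)
            show ?thesis unfolding * using pos ahit_le[OF y1] by simp
          qed
          finally show "avg (\<lambda>x. of_bool (D ?s x)) j y \<le> (M y - ahit y) / c" .
        qed
        also have "\<dots> = (avg M k0 ?s - avg ahit k0 ?s) / c"
          by (simp add: avg_def sum_subtractf diff_divide_distrib sum_divide_distrib[symmetric] mult.commute)
        also have "\<dots> \<le> (v + l / 4 - d) / c"
          using k0(2) n1(2)[OF n] pos
          by (intro divide_right_mono) (auto simp: S_def avg_mlim[OF submart_a s])
        finally show ?thesis .
      qed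
    next
      fix n assume n: "n1 \<le> n"
      let ?s = "?p n"
      have s: "1 \<le> ?s" by (rule path_code_pos)
      define R where "R k \<longleftrightarrow> d < avg ahit k ?s" for k
      have ex: "\<exists>k. R k"
        using n1(3)[OF n] less_mlim_iff[OF submart_ahit s] by (simp add: R_def)
      define k0 where "k0 = (LEAST k. R k)"
      have R: "R k0" unfolding k0_def using ex by (rule LeastI_ex)
      have "\<not> R i" if "i < k0" for i using that unfolding k0_def by (rule not_less_Least)
      with R have S: "S ?s k0" using s by (auto simp: S_def R_def)
      have "c < M (?p (n + k0))" using n by (intro n1) simp
      then obtain i where i: "c < avg a i (?p (n + k0))"
        using less_mlim_iff[OF submart_a path_code_pos] by blast
      \<comment> \<open>The additional level makes the marked prefix strictly longer than
        \<open>?p n\<close> even if \<open>k0\<close> and \<open>i\<close> are 0.\<close>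
      define j where "j = Suc i"
      have "avg a i (?p (n + k0)) \<le> avg a j (?p (n + k0))"
        unfolding j_def by (intro submart_avg_mono[OF submart_a path_code_pos]) simp
      with i have "c < avg a j (?p (n + k0))" by simp
      moreover have "?p (n + k0 + j) div 2 ^ j = ?p (n + k0)" by (simp add: path_code_div)
      moreover have "?p (n + k0 + j) \<in> leaves ?s (k0 + j)"
        using path_code_leaves[of Z n "k0 + j"] by (simp add: add.assoc)
      ultimately have "D ?s (?p (n + k0 + j))"
        using S not_hit_path D_iff[OF s, of _ "k0 + j"] by (auto intro!: exI[of _ j])
      then show "\<exists>m>n. D ?s (?p m)" by (intro exI[of _ "n + k0 + j"]) (simp add: j_def)
    qed
  qed
  with \<open>0 \<le> l\<close> l show ?thesis by simp
qed

end

section \<open>Maximal inequalities on the tree\<close>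

lemma card_near_leaves:
  "finite {x. s \<le> x div 2 ^ k + K \<and> x div 2 ^ k \<le> s + K}"
  "card {x. s \<le> x div 2 ^ k + K \<and> x div 2 ^ k \<le> s + K} \<le> (2 * K + 1) * 2 ^ k"
proof -
  let ?N = "{x. s \<le> x div 2 ^ k + K \<and> x div 2 ^ k \<le> s + K}"
  have sub: "?N \<subseteq> (\<Union>t\<in>{s - K..s + K}. leaves t k)"
    by (auto simp: leaves_def)
  then show "finite ?N" by (rule finite_subset) auto
  have "card ?N \<le> card (\<Union>t\<in>{s - K..s + K}. leaves t k)"
    using sub by (intro card_mono) auto
  also have "\<dots> \<le> (\<Sum>t\<in>{s - K..s + K}. card (leaves t k))"
    by (rule card_UN_le) simp
  also have "\<dots> = (Suc (s + K) - (s - K)) * 2 ^ k"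
    by simp
  also have "\<dots> \<le> (2 * K + 1) * 2 ^ k"
    by (intro mult_le_mono1) simp
  finally show "card ?N \<le> (2 * K + 1) * 2 ^ k" .
qed

lemma near_div:
  assumes "(J :: nat) \<le> y + K" "y \<le> J + K"
  shows "J div 2 ^ i \<le> y div 2 ^ i + K" "y div 2 ^ i \<le> J div 2 ^ i + K"
proof -
  have "m div 2 ^ i \<le> n div 2 ^ i + K" if "m \<le> n + K" for m n :: nat
  proof -
    have "K * 1 \<le> K * 2 ^ i" by (intro mult_le_mono2) simp
    with that have "m \<le> n + K * 2 ^ i" by linarith
    then have "m div 2 ^ i \<le> (n + K * 2 ^ i) div 2 ^ i" by (rule div_le_mono)
    then show ?thesis by simp
  qed
  with assms show "J div 2 ^ i \<le> y div 2 ^ i + K" "y div 2 ^ i \<le> J div 2 ^ i + K" by auto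
qed

text \<open>A finite maximal inequality: the \<open>K\<close>-neighbourhood of an interval contains those of its
  subintervals in the tree, so only maximal intervals count.\<close>

lemma card_near_le:
  fixes P :: "nat \<Rightarrow> nat \<Rightarrow> bool" and K :: nat
  defines "Y \<equiv> \<lambda>s k. {x. \<exists>j\<le>k. \<exists>J\<in>leaves s (k - j). J \<le> x div 2 ^ j + K \<and> x div 2 ^ j \<le> J + K \<and> P j J}"
  shows "finite (Y s k) \<and> card (Y s k) \<le> (2 * K + 1) * card {x \<in> leaves s k. \<exists>j\<le>k. P j (x div 2 ^ j)}"
proof (induction k arbitrary: s)
  case (Suc k)
  let ?X = "\<lambda>s k. {x \<in> leaves s k. \<exists>j\<le>k. P j (x div 2 ^ j)}"
  let ?N = "{x. s \<le> x div 2 ^ Suc k + K \<and> x div 2 ^ Suc k \<le> s + K}"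
  show ?case
  proof (cases "P (Suc k) s")
    case True
    have sub: "Y s (Suc k) \<subseteq> ?N"
    proof
      fix x assume "x \<in> Y s (Suc k)"
      then obtain j J where j: "j \<le> Suc k" "J \<in> leaves s (Suc k - j)"
        "J \<le> x div 2 ^ j + K" "x div 2 ^ j \<le> J + K"
        unfolding Y_def by blast
      have "Suc k = j + (Suc k - j)" using j by simp
      then have "x div 2 ^ Suc k = x div 2 ^ j div 2 ^ (Suc k - j)"
        by (metis power_add div_mult2_eq)
      with near_div[OF j(3,4), of "Suc k - j"] j(2) show "x \<in> ?N"
        by (simp add: leaves_def)
    qed
    have "?X s (Suc k) = leaves s (Suc k)"
      using True by (auto simp: leaves_def)
    moreover have "card (Y s (Suc k)) \<le> (2 * K + 1) * 2 ^ Suc k"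
      using card_mono[OF card_near_leaves(1) sub] card_near_leaves(2) by (rule order_trans)
    ultimately show ?thesis
      using finite_subset[OF sub card_near_leaves(1)] by (simp only: card_leaves)
  next
    case False
    have sub: "Y s (Suc k) \<subseteq> Y (2 * s) k \<union> Y (2 * s + 1) k"
    proof
      fix x assume "x \<in> Y s (Suc k)"
      then obtain j J where j: "j \<le> Suc k" "J \<in> leaves s (Suc k - j)"
        "J \<le> x div 2 ^ j + K" "x div 2 ^ j \<le> J + K" "P j J"
        unfolding Y_def by blast
      have "j \<noteq> Suc k" using j False by auto
      with j(1) have "j \<le> k" "Suc k - j = Suc (k - j)" by auto
      with j show "x \<in> Y (2 * s) k \<union> Y (2 * s + 1) k"
        unfolding Y_def by (auto simp: leaves_Suc)
    qed
    have fin: "finite (Y (2 * s) k \<union> Y (2 * s + 1) k)" using Suc.IH by simp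
    have le: "card (Y s (Suc k)) \<le> card (Y (2 * s) k) + card (Y (2 * s + 1) k)"
      by (rule order_trans[OF card_mono[OF fin sub] card_Un_le])
    have "?X (2 * s) k \<union> ?X (2 * s + 1) k \<subseteq> ?X s (Suc k)"
      by (auto simp: leaves_Suc intro: le_SucI)
    then have "card (?X (2 * s) k \<union> ?X (2 * s + 1) k) \<le> card (?X s (Suc k))"
      by (intro card_mono) auto
    moreover have "card (?X (2 * s) k \<union> ?X (2 * s + 1) k) = card (?X (2 * s) k) + card (?X (2 * s + 1) k)"
      by (intro card_Un_disjoint) (simp, simp, auto simp: leaves_def)
    ultimately have "(2 * K + 1) * (card (?X (2 * s) k) + card (?X (2 * s + 1) k)) \<le> (2 * K + 1) * card (?X s (Suc k))"
      by (intro mult_le_mono2) simp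
    moreover have "card (Y (2 * s) k) + card (Y (2 * s + 1) k) \<le>
        (2 * K + 1) * (card (?X (2 * s) k) + card (?X (2 * s + 1) k))"
      unfolding add_mult_distrib2 using Suc.IH by (intro add_mono) blast+
    ultimately show ?thesis
      using le finite_subset[OF sub fin] by linarith
  qed
next
  case 0
  have "Y s 0 = (if P 0 s then {x. s \<le> x div 2 ^ 0 + K \<and> x div 2 ^ 0 \<le> s + K} else {})"
    by (auto simp: Y_def)
  moreover have "{x \<in> leaves s 0. \<exists>j\<le>0. P j (x div 2 ^ j)} = (if P 0 s then {s} else {})"
    by auto
  ultimately show ?case using card_near_leaves[of s 0 K] by (cases "P 0 s") simp_all
qed

lemma avg_near_le:
  "avg (\<lambda>x. of_bool (\<exists>j\<le>k. \<exists>J\<in>leaves s (k - j). J \<le> x div 2 ^ j + K \<and> x div 2 ^ j \<le> J + K \<and> P j J)) k s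
    \<le> (2 * real K + 1) * avg (\<lambda>x. of_bool (\<exists>j\<le>k. P j (x div 2 ^ j))) k s"
proof -
  let ?Q = "\<lambda>x. \<exists>j\<le>k. \<exists>J\<in>leaves s (k - j). J \<le> x div 2 ^ j + K \<and> x div 2 ^ j \<le> J + K \<and> P j J"
  note le = card_near_le[where s = s and k = k and K = K and P = P]
  have "card {x \<in> leaves s k. ?Q x} \<le> card {x. ?Q x}"
    using le by (intro card_mono) auto
  also have "\<dots> \<le> (2 * K + 1) * card {x \<in> leaves s k. \<exists>j\<le>k. P j (x div 2 ^ j)}"
    using le by blast
  finally have "real (card {x \<in> leaves s k. ?Q x}) \<le>
      real ((2 * K + 1) * card {x \<in> leaves s k. \<exists>j\<le>k. P j (x div 2 ^ j)})"
    by (rule of_nat_mono)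
  also have "\<dots> = (2 * real K + 1) * real (card {x \<in> leaves s k. \<exists>j\<le>k. P j (x div 2 ^ j)})"
    by (simp add: distrib_right)
  finally show ?thesis
    unfolding avg_of_bool times_divide_eq_right by (rule divide_right_mono) simp
qed

text \<open>Optional stopping: a submartingale stopped at the first node where it is below
  \<open>q\<close> still has average at least \<open>b y\<close>, and raising its value there to
  \<open>q\<close> only helps. Without stopping, \<open>b\<close> could recover after a
  drop.\<close>

lemma submart_le_avg_stopped:
  assumes "submart b" "1 \<le> y"
  shows "b y \<le> avg (\<lambda>x. if \<exists>i\<le>j. b (x div 2 ^ i) < q then q else b x) j y"
  using assms(2)
proof (induction j arbitrary: y)
  case (Suc j)
  let ?f = "\<lambda>j x. if \<exists>i\<le>j. b (x div 2 ^ i) < q then q else b x"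
  show ?case
  proof (cases "b y < q")
    case True
    have "avg (?f (Suc j)) (Suc j) y = avg (\<lambda>x. q) (Suc j) y"
      by (rule avg_cong) (use True in \<open>auto simp: leaves_def simp del: power_Suc\<close>)
    then show ?thesis using True by (simp add: avg_def)
  next
    case False
    have eq: "avg (?f (Suc j)) j c = avg (?f j) j c" if "c div 2 = y" for c
    proof (rule avg_cong)
      fix x assume "x \<in> leaves c j"
      then have "x div 2 ^ Suc j = y"
        using that by (simp only: leaves_def mem_Collect_eq power_Suc2 div_mult2_eq)
      then show "?f (Suc j) x = ?f j x" using False by (metis le_Suc_eq)
    qed
    have "b y \<le> (b (2 * y) + b (2 * y + 1)) / 2"
      using submart_step[OF assms(1) Suc.prems] .
    also have "\<dots> \<le> (avg (?f j) j (2 * y) + avg (?f j) j (2 * y + 1)) / 2"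
      using Suc.prems by (intro divide_right_mono add_mono Suc.IH) auto
    finally show ?thesis unfolding avg_Suc by (simp add: eq)
  qed
qed simp

text \<open>The leaves that have an ancestor with average above \<open>p\<close> split up according
  to their topmost such ancestor, and below each of these \<open>b\<close> has average more than
  \<open>p\<close>.\<close>

lemma avg_maximal_le:
  assumes "1 \<le> y"
  shows "p * avg (\<lambda>x. of_bool (\<exists>i\<le>j. p < avg b i (x div 2 ^ i))) j y \<le>
    avg (\<lambda>x. if \<exists>i\<le>j. p < avg b i (x div 2 ^ i) then b x else 0) j y"
  using assms
proof (induction j arbitrary: y)
  case (Suc j)
  let ?H = "\<lambda>j x. \<exists>i\<le>j. p < avg b i (x div 2 ^ i)"
  show ?case
  proof (cases "p < avg b (Suc j) y")
    case True
    have H: "?H (Suc j) x" if "x \<in> leaves y (Suc j)" for x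
      using that True by (auto simp: leaves_def simp del: power_Suc)
    have "avg (\<lambda>x. of_bool (?H (Suc j) x)) (Suc j) y = 1"
      using H by (rule avg_of_bool_all)
    moreover have "avg (\<lambda>x. if ?H (Suc j) x then b x else 0) (Suc j) y = avg b (Suc j) y"
      by (rule avg_cong) (simp only: H if_True)
    ultimately show ?thesis using True by simp
  next
    case False
    have H: "?H (Suc j) x \<longleftrightarrow> ?H j x" if "c div 2 = y" "x \<in> leaves c j" for c x
    proof -
      have "x div 2 ^ Suc j = y"
        using that by (simp only: leaves_def mem_Collect_eq power_Suc2 div_mult2_eq)
      then show ?thesis using False by (metis le_Suc_eq)
    qed
    have eq: "avg (\<lambda>x. of_bool (?H (Suc j) x)) j c = avg (\<lambda>x. of_bool (?H j x)) j c"
      "avg (\<lambda>x. if ?H (Suc j) x then b x else 0) j c = avg (\<lambda>x. if ?H j x then b x else 0) j c"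
      if "c div 2 = y" for c
      by (rule avg_cong, simp only: H[OF that])+
    show ?thesis
      using Suc.IH[of "2 * y"] Suc.IH[of "2 * y + 1"] Suc.prems
      unfolding avg_Suc by (simp add: eq distrib_left)
  qed
qed simp


text \<open>All leaves below a node with average above \<open>p\<close> are hit, so the maximal
  inequality charges them to the capital \<open>Mhit\<close>.\<close>

lemma (in density_path) avg_high_le:
  assumes "1 \<le> s" "n0 \<le> lev s"
  shows "p * avg (\<lambda>x. of_bool (\<exists>j\<le>k. p < avg a j (x div 2 ^ j))) k s \<le> Mhit s"
proof -
  have "p * avg (\<lambda>x. of_bool (\<exists>j\<le>k. p < avg a j (x div 2 ^ j))) k s
      \<le> avg (\<lambda>x. if \<exists>j\<le>k. p < avg a j (x div 2 ^ j) then a x else 0) k s"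
    using assms(1) by (rule avg_maximal_le)
  also have "\<dots> \<le> avg ahit k s"
  proof (rule avg_mono)
    fix x assume x: "x \<in> leaves s k"
    have "hit x" if j: "j \<le> k" "p < avg a j (x div 2 ^ j)" for j
    proof (rule hitI)
      have l: "x div 2 ^ j \<in> leaves s (k - j)" using x j(1) by (rule leaves_div)
      show "1 \<le> x div 2 ^ j" using leaves_pos[OF l assms(1)] .
      show "n0 \<le> lev (x div 2 ^ j)" using lev_leaves[OF l assms(1)] assms(2) by simp
      show "x \<in> leaves (x div 2 ^ j) j" by (simp add: leaves_def)
    qed (fact j)
    then show "(if \<exists>j\<le>k. p < avg a j (x div 2 ^ j) then a x else 0) \<le> ahit x"
      by (auto simp: ahit_altdef a_nonneg)
  qed
  also have "\<dots> \<le> Mhit s" using submart_ahit assms(1) by (rule avg_le_mlim)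
  finally show ?thesis .
qed

text \<open>Let \<open>i\<close> be the first depth at which the average of \<open>a\<close> reaches
  \<open>w\<close>. The process that starts there and stops on falling below \<open>q\<close> has
  average at least \<open>w\<close>. It is at most \<open>q\<close> on the low paths and at most
  \<open>p\<close> on the others, except for an excess on hit leaves that is bounded by
  \<open>ahit\<close>. Hence \<open>w\<close> is at most \<open>p\<close> minus \<open>p - q\<close>
  times the low proportion, plus \<open>Mhit s\<close>.\<close>

lemma (in density_path) avg_low_le:
  assumes "1 \<le> s" "n0 \<le> lev s" "q < p" "w \<le> p"
  shows "(p - q) * avg (\<lambda>x. of_bool (\<exists>j\<le>k. a (x div 2 ^ j) < q \<and> w \<le> avg a (k - j) s)) k s
    \<le> p - w + Mhit s"
proof (cases "\<exists>i\<le>k. w \<le> avg a i s")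
  case False
  then have "avg (\<lambda>x. of_bool (\<exists>j\<le>k. a (x div 2 ^ j) < q \<and> w \<le> avg a (k - j) s)) k s = avg (\<lambda>x. 0) k s"
    by (intro avg_cong) (use diff_le_self in auto)
  then show ?thesis
    using assms(4) mlim_nonneg[OF submart_ahit assms(1)] by (simp add: avg_def)
next
  case True
  define i where "i = (LEAST i. w \<le> avg a i s)"
  have i: "w \<le> avg a i s" unfolding i_def using True by (metis LeastI)
  have "i \<le> k" unfolding i_def using True Least_le order_trans by metis
  have le_iff: "w \<le> avg a l s \<longleftrightarrow> i \<le> l" for l
    using submart_avg_mono[OF submart_a assms(1), of i l] i order_trans Least_le[of "\<lambda>i. w \<le> avg a i s" l]
    unfolding i_def by blast
  define low where "low x \<longleftrightarrow> (\<exists>j\<le>k - i. a (x div 2 ^ j) < q)" for x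
  have low_iff: "(\<exists>j\<le>k. a (x div 2 ^ j) < q \<and> w \<le> avg a (k - j) s) \<longleftrightarrow> low x" for x
    unfolding le_iff low_def using \<open>i \<le> k\<close>
    by (metis diff_diff_cancel diff_le_mono2 diff_le_self order_trans)
  have "w \<le> avg a i s" by (fact i)
  also have "\<dots> \<le> avg (avg (\<lambda>x. if low x then q else a x) (k - i)) i s"
    unfolding low_def
    by (rule avg_mono) (rule submart_le_avg_stopped[OF submart_a leaves_pos[OF _ assms(1)]])
  also have "\<dots> = avg (\<lambda>x. if low x then q else a x) k s"
    using \<open>i \<le> k\<close> avg_add[of _ i "k - i" s] by simp
  also have "\<dots> \<le> avg (\<lambda>x. (p + (q - p) * of_bool (low x)) + ahit x) k s"
  proof (rule avg_mono)
    fix x assume x: "x \<in> leaves s k"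
    have "hit x" if "p < a x"
      using that assms leaves_pos[OF x assms(1)] lev_leaves[OF x assms(1)] by (intro hitI[of x x 0]) auto
    then show "(if low x then q else a x) \<le> p + (q - p) * of_bool (low x) + ahit x"
      using p_pos by (cases "p < a x") (auto simp: ahit_altdef a_nonneg)
  qed
  also have "\<dots> = p + (q - p) * avg (\<lambda>x. of_bool (low x)) k s + avg ahit k s"
    by (simp only: avg_plus[of "\<lambda>x. p + (q - p) * of_bool (low x)" ahit] avg_affine)
  also have "avg ahit k s \<le> Mhit s" using submart_ahit assms(1) by (rule avg_le_mlim)
  finally show ?thesis unfolding low_iff by (simp add: left_diff_distrib)
qed

text \<open>The alternative in the assumption on \<open>q0\<close> allows for \<open>v = 0\<close>:
  slopes are nonnegative, so none is below a nonpositive \<open>q0\<close>, and \<open>q = 0\<close>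
  serves as the rational bound. Otherwise \<open>q\<close> is chosen below \<open>v\<close>.\<close>

lemma no_deviation:
  assumes rec_A: "total_recursive 1 (\<lambda>xs. A (xs ! 0))" and submart_a: "submart (dyadic A)"
    and Z: "convergence_path Z" and v: "(\<lambda>n. mlim (dyadic A) (path_code Z n)) \<longlonglongrightarrow> v"
    and p0: "v < p0" and q0: "q0 < v \<or> q0 \<le> 0"
    and dev: "\<And>n m0. \<exists>m\<ge>m0. n \<le> m \<and> (\<exists>J\<in>leaves (path_code Z n) (m - n).
       J \<le> path_code Z m + K \<and> path_code Z m \<le> J + K \<and> (p0 < mlim (dyadic A) J \<or> mlim (dyadic A) J < q0))"
  shows False
proof -
  let ?p = "path_code Z"
  have v0: "0 \<le> v"
    using v by (rule LIMSEQ_le_const) (auto intro: mlim_nonneg submart_a path_code_pos)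
  obtain q where q: "q \<in> \<rat>" "0 \<le> q" "q0 \<le> q" "0 < v \<and> q < v \<or> v = 0 \<and> q = 0"
  proof (cases "v = 0")
    case True
    then show ?thesis using q0 by (intro that[of 0]) auto
  next
    case False
    then have "max q0 0 < v" using v0 q0 by auto
    then show ?thesis using Rats_dense_in_real[of "max q0 0" v] v0 that by force
  qed
  define L where "L = 2 * real K + 1"
  have L: "1 \<le> L" by (simp add: L_def)
  \<comment> \<open>For \<open>v > 0\<close>, \<open>g\<close> is at most \<open>p - q\<close>. As
    \<open>p\<close>, \<open>w\<close> and the bound \<open>d\<close> on \<open>Mhit\<close> are
    within \<open>g / (16 * L)\<close> of \<open>v\<close>, \<open>v\<close> and 0, the low
    proportion is at most \<open>3 / (16 * L)\<close>; \<open>d \<le> p / (4 * L)\<close> bounds the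
    high one by \<open>1 / (4 * L)\<close>. The factor \<open>L\<close> lost to neighbourhoods
    leaves 7/16. For \<open>v = 0\<close> there is no low part, and any positive \<open>g\<close>
    would do.\<close>
  define g where "g = (if v = 0 then 1 else v - q)"
  have g: "0 < g" using q by (auto simp: g_def)
  obtain p where pr: "p \<in> \<rat>" "v < p" "p < p0" "p < v + g / (16 * L)"
    using Rats_dense_in_real[of v "min p0 (v + g / (16 * L))"] p0 g L by auto
  obtain w where w: "w \<in> \<rat>" "0 \<le> w" "v - g / (16 * L) < w" "0 < v \<and> w < v \<or> v = 0 \<and> w = 0"
  proof (cases "v = 0")
    case True
    then show ?thesis using g L by (intro that[of 0]) auto
  next
    case False
    then have "max (v - g / (16 * L)) 0 < v" using v0 g L by auto
    then show ?thesis using Rats_dense_in_real[of "max (v - g / (16 * L)) 0" v] v0 that by force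
  qed
  have qp: "q < p" "w \<le> p" using q(4) w(4) pr(2) by auto
  have "0 < p" using v0 pr by simp
  obtain n0 where n0: "\<And>n. n0 \<le> n \<Longrightarrow> mlim (dyadic A) (?p n) < p"
    using order_tendstoD(2)[OF v pr(2)] by (auto simp: eventually_sequentially)
  interpret density_path A Z v p n0
    using rec_A submart_a Z v pr(1,2) n0 by unfold_locales
  define h where "h = g / (16 * L)"
  define d where "d = min (g / (16 * L)) (p / (4 * L))"
  have d: "0 < d" using g L \<open>0 < p\<close> by (simp add: d_def)
  have "\<forall>\<^sub>F n in sequentially. n0 \<le> n \<and> Mhit (?p n) < d"
    using order_tendstoD(2)[OF Mhit_tendsto_0 d] eventually_ge_at_top[of n0] by eventually_elim simp
  then obtain n1 where n1: "\<And>n. n1 \<le> n \<Longrightarrow> n0 \<le> n" "\<And>n. n1 \<le> n \<Longrightarrow> Mhit (?p n) < d"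
    by (auto simp: eventually_sequentially)
  have "\<forall>\<^sub>F n in sequentially. w < M (?p n) \<or> w = 0"
    using w(4) order_tendstoD(1)[OF v, of w] by (auto elim: eventually_mono)
  then obtain n2 where n2: "\<And>n. n2 \<le> n \<Longrightarrow> w < M (?p n) \<or> w = 0"
    by (auto simp: eventually_sequentially)
  define P where "P s k j J \<longleftrightarrow> p < avg a j J \<or> (a J < q \<and> w \<le> avg a (k - j) s)" for s k j J
  \<comment> \<open>The condition \<open>a J < q\<close> appears as a negated comparison with
    \<open>avg a 0 J\<close>, guarded by positivity, to have the decidable shape of
    \<open>rec_le_avg\<close>. \<open>D_iff\<close> gives the version to work with.\<close>
  define D where "D s x \<longleftrightarrow> (\<exists>j\<le>lev x. lev s + j \<le> lev x \<and>
      (\<exists>J\<le>x div 2 ^ j + K. x div 2 ^ j \<le> J + K \<and> J div 2 ^ (lev x - j - lev s) = s \<and>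
        ((1 \<le> J \<and> p < avg a j J) \<or> ((1 \<le> J \<and> \<not> (1 \<le> J \<and> q \<le> avg a 0 J)) \<and>
           (1 \<le> s \<and> w \<le> avg a (lev x - j - lev s) s)))))" for s x
  have D_iff: "D s x \<longleftrightarrow> (\<exists>j\<le>k. \<exists>J\<in>leaves s (k - j). J \<le> x div 2 ^ j + K \<and> x div 2 ^ j \<le> J + K \<and> P s k j J)"
    if "1 \<le> s" "x \<in> leaves s k" for s x k
  proof -
    have J: "J \<in> leaves s (k - j) \<Longrightarrow> 1 \<le> J" for J j
      using leaves_pos that(1) by blast
    have lev: "lev x = lev s + k" using lev_leaves that by blast
    show ?thesis
    proof
      assume "D s x"
      then obtain j J where j: "lev s + j \<le> lev x" "J \<le> x div 2 ^ j + K" "x div 2 ^ j \<le> J + K"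
        "J div 2 ^ (lev x - j - lev s) = s"
        "p < avg a j J \<or> (\<not> q \<le> a J \<and> w \<le> avg a (lev x - j - lev s) s)"
        unfolding D_def avg_0 by blast
      have "j \<le> k" "lev x - j - lev s = k - j" using j(1) lev by auto
      with j show "\<exists>j\<le>k. \<exists>J\<in>leaves s (k - j). J \<le> x div 2 ^ j + K \<and> x div 2 ^ j \<le> J + K \<and> P s k j J"
        by (intro exI[of _ j] conjI bexI[of _ J]) (auto simp: leaves_def P_def)
    next
      assume "\<exists>j\<le>k. \<exists>J\<in>leaves s (k - j). J \<le> x div 2 ^ j + K \<and> x div 2 ^ j \<le> J + K \<and> P s k j J"
      then obtain j J where j: "j \<le> k" "J \<in> leaves s (k - j)" "J \<le> x div 2 ^ j + K"
        "x div 2 ^ j \<le> J + K" "P s k j J" by blast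
      have "lev x - j - lev s = k - j" using j(1) lev by auto
      with j J[OF j(2)] that(1) show "D s x"
        unfolding D_def by (intro exI[of _ j] exI[of _ J] conjI) (auto simp: lev leaves_def P_def)
    qed
  qed
  show False
  proof (rule convergence_path_test_real[OF Z])
    show "decidable 2 (\<lambda>xs. D (xs ! 0) (xs ! 1))"
      unfolding D_def
      by (intro rec_intros rec_less_avg rec_le_avg rec_A p q w less_imp_le[OF p_pos]) auto
  next
    fix s x k b assume *: "1 \<le> s" "x \<in> leaves s k" "D s x"
    then obtain j J where j: "j \<le> k" "J \<in> leaves s (k - j)" "J \<le> x div 2 ^ j + K"
        "x div 2 ^ j \<le> J + K" "P s k j J"
      using D_iff by blast
    have "1 \<le> J" using j(2) *(1) by (rule leaves_pos)
    then have "avg a j J \<le> avg a (Suc j) J"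
      by (intro submart_avg_mono[OF submart_a]) auto
    \<comment> \<open>Only \<open>j\<close> grows. The depth \<open>k - j\<close> of
      \<open>J\<close> below \<open>s\<close> is unchanged, and with it the condition on
      \<open>w\<close>.\<close>
    with j(5) have "P s (Suc k) (Suc j) J" by (auto simp: P_def)
    with j(1-4) show "D s (2 * x + of_bool b)"
      unfolding D_iff[OF *(1) leaves_child[OF *(2)]]
      by (intro exI[of _ "Suc j"] conjI bexI[of _ J]) (simp_all only: child_div diff_Suc_Suc Suc_le_mono)
  next
    show "(7 / 16 :: real) < 1" by simp
  next
    fix n k assume "max n1 n2 \<le> n"
    then have n: "n1 \<le> n" by simp
    let ?s = "?p n"
    have s: "1 \<le> ?s" "n0 \<le> lev ?s" using n1(1)[OF n] path_code_pos[of Z n] by (simp_all add: lev_path_code)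
    let ?high = "avg (\<lambda>x. of_bool (\<exists>j\<le>k. p < avg a j (x div 2 ^ j))) k ?s"
    let ?low = "avg (\<lambda>x. of_bool (\<exists>j\<le>k. a (x div 2 ^ j) < q \<and> w \<le> avg a (k - j) ?s)) k ?s"
    have "p * ?high \<le> p * (1 / (4 * L))"
      using avg_high_le[OF s, of k] n1(2)[OF n] by (simp add: d_def)
    then have high: "?high \<le> 1 / (4 * L)"
      using \<open>0 < p\<close> by (simp only: mult_le_cancel_left_pos)
    have low: "?low \<le> 3 / (16 * L)"
    proof (cases "v = 0")
      case True
      then have "q = 0" using q by simp
      then have "?low = avg (\<lambda>x. 0) k ?s"
        by (intro avg_cong) (use a_nonneg in \<open>auto simp: not_less\<close>)
      then show ?thesis using L by (simp add: avg_def)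
    next
      case False
      then have "g \<le> p - q" using p by (simp add: g_def)
      then have "g * ?low \<le> (p - q) * ?low"
        by (intro mult_right_mono avg_nonneg) auto
      also have "\<dots> \<le> p - w + Mhit ?s"
        using avg_low_le[OF s qp] .
      also have "\<dots> \<le> 3 * h"
        using pr(4) w(3) n1(2)[OF n] by (simp add: d_def flip: h_def)
      also have "\<dots> = g * (3 / (16 * L))" by (simp add: h_def)
      finally show ?thesis using g by (simp only: mult_le_cancel_left_pos)
    qed
    have "avg (\<lambda>x. of_bool (D ?s x)) k ?s = avg (\<lambda>x. of_bool (\<exists>j\<le>k. \<exists>J\<in>leaves ?s (k - j).
        J \<le> x div 2 ^ j + K \<and> x div 2 ^ j \<le> J + K \<and> P ?s k j J)) k ?s"
      by (rule avg_cong) (simp only: D_iff[OF s(1)])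
    also have "\<dots> \<le> L * avg (\<lambda>x. of_bool (\<exists>j\<le>k. P ?s k j (x div 2 ^ j))) k ?s"
      unfolding L_def by (rule avg_near_le)
    also have "\<dots> \<le> L * (?high + ?low)"
      unfolding avg_plus[symmetric] P_def using L
      by (intro mult_left_mono avg_mono) auto
    also have "\<dots> \<le> L * (1 / (4 * L) + 3 / (16 * L))"
      using high low L by (intro mult_left_mono add_mono) auto
    also have "\<dots> = 7 / 16" using L by (simp add: field_simps)
    finally show "avg (\<lambda>x. of_bool (D ?s x)) k ?s \<le> 7 / 16" .
  next
    fix n assume n: "max n1 n2 \<le> n"
    let ?s = "?p n"
    have s: "1 \<le> ?s" by (rule path_code_pos)
    obtain i where i: "w \<le> avg a i ?s"
    proof (cases "w = 0")
      case True
      then show ?thesis using submart_avg_nonneg[OF submart_a s] that by blast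
    next
      case False
      then have "w < M ?s" using n2[of n] n by simp
      then show ?thesis using less_mlim_iff[OF submart_a s] that less_imp_le by blast
    qed
    \<comment> \<open>Depth greater than \<open>i\<close> ensures that the average over
      \<open>?s\<close> has reached \<open>w\<close> at the level of \<open>J\<close>, and that
      \<open>m > n\<close>.\<close>
    from dev[where n = n and ?m0.0 = "n + Suc i"] obtain m J where m: "n + Suc i \<le> m" "J \<in> leaves ?s (m - n)"
      "J \<le> ?p m + K" "?p m \<le> J + K" "p0 < M J \<or> M J < q0" by blast
    have J: "1 \<le> J" using m(2) s by (rule leaves_pos)
    from m(5) show "\<exists>m>n. D ?s (?p m)"
    proof
      assume "p0 < M J"
      with pr have "p < M J" by simp
      then obtain j where j: "p < avg a j J" using less_mlim_iff[OF submart_a J] by blast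
      \<comment> \<open>That \<open>M J\<close> exceeds \<open>p\<close> shows only \<open>j\<close>
        levels below \<open>J\<close>, so the mark is found on a longer prefix. A low value of
        \<open>a\<close> is visible at once.\<close>
      have "?p (m + j) \<in> leaves ?s (m - n + j)"
        using path_code_leaves[of Z n "m - n + j"] m(1) by simp
      then have "D ?s (?p (m + j))"
        using m j path_code_div[of j "m + j" Z] D_iff[OF s]
        by (auto simp: P_def intro!: exI[of _ j] bexI[of _ J])
      then show ?thesis using m(1) by (intro exI[of _ "m + j"]) simp
    next
      assume "M J < q0"
      then have "a J < q" using q(3) le_mlim[OF submart_a J] by simp
      moreover have "i \<le> m - n" using m(1) by simp
      then have "w \<le> avg a (m - n) ?s"
        by (rule order_trans[OF i submart_avg_mono[OF submart_a s]])
      moreover have "?p m \<in> leaves ?s (m - n)"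
        using path_code_leaves[of Z n "m - n"] m(1) by simp
      ultimately have "D ?s (?p m)"
        using m D_iff[OF s] by (auto simp: P_def intro!: exI[of _ 0] bexI[of _ J])
      then show ?thesis using m(1) by (intro exI[of _ m]) simp
    qed
  qed
qed

section \<open>Recursive approximation of the slope martingale\<close>

lemma ce_imp_decidable:
  assumes "ce E"
  obtains Q where "decidable 2 (\<lambda>xs. Q (xs ! 0) (xs ! 1))" "\<And>x. x \<in> E \<longleftrightarrow> (\<exists>t. Q x t)"
proof (cases "E = {}")
  case True
  have "decidable 2 (\<lambda>xs. False)" by (intro rec_intros)
  then show ?thesis using True by (intro that[of "\<lambda>_ _. False"]) auto
next
  case False
  then obtain g where g: "total_recursive 1 g" "E = range (\<lambda>n. g [n])"
    using assms by (auto simp: ce_def)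
  have "total_recursive 1 (\<lambda>xs. g [xs ! 0])"
    by (rule total_recursive.ext[OF g(1)]) (auto simp: length_Suc_conv)
  note g' = rec_comp1[where F = "\<lambda>x. g [x]", OF this]
  show ?thesis
  proof (rule that[of "\<lambda>x t. x = g [t]"])
    show "decidable 2 (\<lambda>xs. xs ! 0 = g [xs ! 1])" by (intro rec_intros g') auto
  qed (use g(2) in auto)
qed

text \<open>The value at stage \<open>s\<close> of the approximation to \<open>M n\<close> is rounded down to a multiple of
  \<open>1 / 2 ^ lev n\<close> that is below \<open>M n\<close> by at least that amount. So at level \<open>L + 1\<close> one can wait for a stage
  whose averages dominate the approximations made at all smaller levels.\<close>

locale left_ce_approx =
  fixes M :: "nat \<Rightarrow> real" and Q :: "nat \<Rightarrow> nat \<Rightarrow> nat \<Rightarrow> bool"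
  assumes M_nonneg: "\<And>n. 1 \<le> n \<Longrightarrow> 0 \<le> M n"
    and M_double: "\<And>n. 1 \<le> n \<Longrightarrow> M n = (M (2 * n) + M (2 * n + 1)) / 2"
    and dec_Q: "decidable 3 (\<lambda>xs. Q (xs ! 0) (xs ! 1) (xs ! 2))"
    and Q: "\<And>n m. 1 \<le> n \<Longrightarrow> (\<exists>t. Q n m t) \<longleftrightarrow> real (m + 1) / 2 ^ lev n < M n"
begin

text \<open>The largest \<open>m \<le> s\<close> enumerated by stage \<open>s\<close>, or 0 if there
  is none. As a least upper bound it is found by a search that always succeeds.\<close>

definition ap :: "nat \<Rightarrow> nat \<Rightarrow> nat" where
  "ap s n = (LEAST u. \<forall>m\<le>s. (\<exists>t\<le>s. Q n m t) \<longrightarrow> m \<le> u)"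

lemma rec_ap:
  assumes "total_recursive n f" "total_recursive n g"
  shows "total_recursive n (\<lambda>xs. ap (f xs) (g xs))"
proof -
  note Q = rec_comp3[where F = "\<lambda>x y z. of_bool (Q x y z)", OF dec_Q]
  have "total_recursive 2 (\<lambda>xs. ap (xs ! 0) (xs ! 1))"
    unfolding ap_def by (intro rec_Least rec_intros Q) auto
  then show ?thesis using assms by (rule rec_comp2)
qed

lemma le_ap: "m \<le> s \<Longrightarrow> t \<le> s \<Longrightarrow> Q n m t \<Longrightarrow> m \<le> ap s n"
proof -
  have "\<forall>m\<le>s. (\<exists>t\<le>s. Q n m t) \<longrightarrow> m \<le> ap s n"
    unfolding ap_def by (rule LeastI[of _ s]) simp
  then show "m \<le> s \<Longrightarrow> t \<le> s \<Longrightarrow> Q n m t \<Longrightarrow> m \<le> ap s n" by blast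
qed

lemma ap_cases: "ap s n = 0 \<or> (\<exists>t. Q n (ap s n) t)"
proof (cases "ap s n")
  case (Suc u)
  then have "\<not> (\<forall>m\<le>s. (\<exists>t\<le>s. Q n m t) \<longrightarrow> m \<le> u)"
    unfolding ap_def by (intro not_less_Least) simp
  then obtain m t where m: "m \<le> s" "t \<le> s" "Q n m t" "u < m" by (meson not_le)
  with le_ap[OF m(1-3)] Suc have "m = ap s n" by simp
  with m show ?thesis by blast
qed simp

lemma ap_less: "1 \<le> n \<Longrightarrow> ap s n = 0 \<or> real (ap s n + 1) / 2 ^ lev n < M n"
  using ap_cases[of s n] Q by blast

lemma ap_le: "1 \<le> n \<Longrightarrow> real (ap s n) / 2 ^ lev n \<le> M n"
  using ap_less[of n s] M_nonneg[of n] by (auto simp: add_divide_distrib intro: order_trans[rotated] less_imp_le)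

lemma eventually_ap:
  assumes "1 \<le> n"
  shows "\<forall>\<^sub>F s in sequentially. M n - 2 / 2 ^ lev n \<le> real (ap s n) / 2 ^ lev n"
proof (cases "M n \<le> 2 / 2 ^ lev n")
  case True
  have "M n - 2 / 2 ^ lev n \<le> real (ap s n) / 2 ^ lev n" for s
  proof (rule order_trans)
    show "M n - 2 / 2 ^ lev n \<le> 0" using True by simp
  qed simp
  then show ?thesis by simp
next
  case False
  define c where "c = \<lceil>M n * 2 ^ lev n\<rceil>"
  have "2 < M n * 2 ^ lev n" using False by (simp add: pos_divide_less_eq not_le)
  then have "2 < c" unfolding c_def by linarith
  \<comment> \<open>The largest \<open>m\<close> with \<open>m + 1\<close> strictly below
    \<open>M n * 2 ^ lev n\<close>. One unit of the error 2 is the safety margin, the other is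
    rounding.\<close>
  define m where "m = nat (c - 2)"
  have m: "real m = c - 2" using \<open>2 < c\<close> by (simp add: m_def)
  have "real (m + 1) < M n * 2 ^ lev n" "M n * 2 ^ lev n - 2 \<le> real m"
    using m unfolding c_def by linarith+
  then have 1: "real (m + 1) / 2 ^ lev n < M n" and 2: "M n - 2 / 2 ^ lev n \<le> real m / 2 ^ lev n"
    by (simp_all add: pos_divide_less_eq pos_le_divide_eq left_diff_distrib)
  obtain t where t: "Q n m t" using Q[OF assms] 1 by blast
  show ?thesis
    unfolding eventually_sequentially
  proof (intro exI allI impI)
    fix s assume "max m t \<le> s"
    then have "m \<le> ap s n" using t by (intro le_ap) auto
    then have "real m / 2 ^ lev n \<le> real (ap s n) / 2 ^ lev n" by (simp add: divide_right_mono)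
    with 2 show "M n - 2 / 2 ^ lev n \<le> real (ap s n) / 2 ^ lev n" by linarith
  qed
qed

lemma avg_M: "1 \<le> n \<Longrightarrow> avg M k n = M n"
proof (induction k arbitrary: n)
  case (Suc k)
  then show ?case using M_double[OF Suc.prems] by (simp add: avg_Suc)
qed simp

lemma eventually_avg_ap:
  assumes "1 \<le> n"
  shows "\<forall>\<^sub>F s in sequentially. M n - 2 / 2 ^ (lev n + k) \<le> avg (dyadic (ap s)) k n"
proof -
  have "\<forall>\<^sub>F s in sequentially. \<forall>y\<in>leaves n k. M y - 2 / 2 ^ lev y \<le> real (ap s y) / 2 ^ lev y"
    by (intro eventually_ball_finite ballI eventually_ap leaves_pos[OF _ assms]) auto
  then show ?thesis
  proof eventually_elim
    case (elim s)
    have "avg (\<lambda>y. - (2 / 2 ^ (lev n + k)) + 1 * M y) k n \<le> avg (dyadic (ap s)) k n"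
      using elim lev_leaves[OF _ assms] by (intro avg_mono) (auto simp: dyadic_def)
    then show ?case unfolding avg_affine using avg_M[OF assms, of k] by simp
  qed
qed

text \<open>The domination property in \<open>ready_iff\<close> with denominators cleared, hence
  decidable.\<close>

definition ready :: "nat \<Rightarrow> nat \<Rightarrow> nat \<Rightarrow> bool" where
  "ready L s s' \<longleftrightarrow> s < s' \<and> (\<forall>n<2 ^ Suc L. 1 \<le> n \<longrightarrow>
     ap s n * 4 ^ (Suc L - lev n) \<le> leaf_sum (ap s') (Suc L - lev n) n)"

lemma ready_iff:
  "ready L s s' \<longleftrightarrow> s < s' \<and> (\<forall>n<2 ^ Suc L. 1 \<le> n \<longrightarrow>
     real (ap s n) / 2 ^ lev n \<le> avg (dyadic (ap s')) (Suc L - lev n) n)"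
proof -
  have "a * d \<le> b \<longleftrightarrow> real a / l \<le> real b / (l * real d)" if "0 < l" "0 < d" for a b d :: nat and l :: real
  proof -
    have "real a / l \<le> real b / (l * real d) \<longleftrightarrow> real (a * d) \<le> real b"
      using that by (simp add: pos_divide_le_eq pos_le_divide_eq field_simps)
    then show ?thesis by (simp only: of_nat_le_iff)
  qed
  then have "ap s n * 4 ^ k \<le> leaf_sum (ap s') k n \<longleftrightarrow> real (ap s n) / 2 ^ lev n \<le> avg (dyadic (ap s')) k n"
    if "1 \<le> n" for n k
    unfolding avg_dyadic[OF that] of_nat_mult of_nat_power of_nat_numeral
    by (metis of_nat_numeral of_nat_power zero_less_numeral zero_less_power)
  then show ?thesis unfolding ready_def by blast
qed

text \<open>Unless it is 0, the approximation at \<open>n\<close> stays below \<open>M n\<close> by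
  more than \<open>1 / 2 ^ lev n\<close>, while its averages at level \<open>L + 1\<close>
  eventually come within \<open>2 / 2 ^ Suc L\<close>, which is no more than that margin because
  \<open>lev n \<le> L\<close>.\<close>

lemma ex_ready: "\<exists>s'. ready L s s'"
proof -
  have "\<forall>\<^sub>F s' in sequentially. real (ap s n) / 2 ^ lev n \<le> avg (dyadic (ap s')) (Suc L - lev n) n"
    if "n < 2 ^ Suc L" "1 \<le> n" for n
  proof (cases "ap s n = 0")
    case True
    then show ?thesis by (simp add: avg_nonneg dyadic_def)
  next
    case False
    have "(2::nat) ^ lev n < 2 ^ Suc L" using lev_le[OF that(2)] that(1) by (rule le_less_trans)
    then have "lev n < Suc L" by (simp del: power_Suc)
    then have l: "lev n + (Suc L - lev n) = Suc L" "lev n \<le> L" by auto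
    have "real (ap s n) / 2 ^ lev n < M n - 1 / 2 ^ lev n"
      using ap_less[OF that(2), of s] False by (simp add: add_divide_distrib)
    also have "\<dots> \<le> M n - 1 / 2 ^ L"
      using l(2) by (intro diff_left_mono divide_left_mono power_increasing) auto
    also have "\<dots> = M n - 2 / 2 ^ (lev n + (Suc L - lev n))" by (simp add: l)
    finally show ?thesis
      using eventually_avg_ap[OF that(2), of "Suc L - lev n"] by (auto elim: eventually_mono)
  qed
  then have "\<forall>\<^sub>F s' in sequentially. \<forall>n\<in>{1..<2 ^ Suc L}.
      real (ap s n) / 2 ^ lev n \<le> avg (dyadic (ap s')) (Suc L - lev n) n"
    by (intro eventually_ball_finite) auto
  then have "\<forall>\<^sub>F s' in sequentially. ready L s s'"
    using eventually_gt_at_top[of s] by eventually_elim (auto simp: ready_iff)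
  then show ?thesis by (auto simp: eventually_sequentially)
qed

definition stage :: "nat \<Rightarrow> nat" where
  "stage L = rec_nat 0 (\<lambda>L s. LEAST s'. ready L s s') L"

lemma ready_stage: "ready L (stage L) (stage (Suc L))"
  unfolding stage_def old.nat.simps(7) using ex_ready by (rule LeastI_ex)

lemma stage_ge: "L \<le> stage L"
proof (induction L)
  case (Suc L)
  then show ?case using ready_stage[of L] by (simp add: ready_def)
qed simp

definition A :: "nat \<Rightarrow> nat" where
  "A n = ap (stage (lev n)) n"

lemma rec_A: "total_recursive 1 (\<lambda>xs. A (xs ! 0))"
proof -
  have "total_recursive 2 (\<lambda>xs. LEAST s'. ready (xs ! 0) (xs ! 1) s')"
    unfolding ready_def by (intro rec_Least rec_intros rec_ap) (use ex_ready in \<open>auto simp: ready_def\<close>)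
  note step = rec_comp2[where F = "\<lambda>x y. LEAST s'. ready x y s'", OF this]
  show ?thesis
    unfolding A_def stage_def by (intro rec_ap rec_intros step) auto
qed

lemma le_avg_A:
  assumes "1 \<le> n" "lev n \<le> L"
  shows "real (ap (stage L) n) / 2 ^ lev n \<le> avg (dyadic A) (Suc L - lev n) n"
proof -
  have "(2::nat) ^ Suc (lev n) \<le> 2 ^ Suc L" using assms(2) by (intro power_increasing) auto
  with less_lev[of n] have "n < 2 ^ Suc L" by (rule less_le_trans)
  then have "real (ap (stage L) n) / 2 ^ lev n \<le> avg (dyadic (ap (stage (Suc L)))) (Suc L - lev n) n"
    using ready_stage[of L] assms(1) by (simp add: ready_iff del: power_Suc)
  also have "\<dots> = avg (dyadic A) (Suc L - lev n) n"
    using assms unfolding avg_def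
    by (intro arg_cong2[of _ _ _ _ "(/)"] sum.cong) (auto simp: dyadic_def A_def lev_leaves)
  finally show ?thesis .
qed

lemma avg_A_le: "1 \<le> n \<Longrightarrow> avg (dyadic A) k n \<le> M n"
proof -
  assume n: "1 \<le> n"
  have "avg (dyadic A) k n \<le> avg M k n"
    unfolding dyadic_def A_def by (rule avg_mono) (rule ap_le[OF leaves_pos[OF _ n]])
  then show ?thesis using avg_M[OF n] by simp
qed

lemma submart_A: "submart (dyadic A)"
  unfolding submart_def
proof (intro conjI allI impI)
  fix n :: nat assume n: "1 \<le> n"
  show "0 \<le> dyadic A n" by (simp add: dyadic_def)
  show "dyadic A n \<le> (dyadic A (2 * n) + dyadic A (2 * n + 1)) / 2"
    using le_avg_A[OF n order_refl] by (simp add: avg_Suc dyadic_def[of A n] A_def[of n])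
  show "\<exists>C. \<forall>k. avg (dyadic A) k n \<le> C" using avg_A_le[OF n] by blast
qed

text \<open>At depth \<open>j\<close> a late stage has error at most
  \<open>2 / 2 ^ (lev n + j)\<close> on average, and \<open>le_avg_A\<close> passes the values of
  that stage on to averages of \<open>A\<close> further down. The errors tend to 0 with
  \<open>j\<close>.\<close>

lemma mlim_A:
  assumes n: "1 \<le> n"
  shows "mlim (dyadic A) n = M n"
proof (rule antisym)
  show "mlim (dyadic A) n \<le> M n"
    by (rule LIMSEQ_le_const2[OF submart_mlim[OF submart_A n]]) (use avg_A_le[OF n] in blast)
  have "M n - 2 / 2 ^ (lev n + j) \<le> mlim (dyadic A) n" for j
  proof -
    obtain S where S: "\<And>s. S \<le> s \<Longrightarrow> M n - 2 / 2 ^ (lev n + j) \<le> avg (dyadic (ap s)) j n"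
      using eventually_avg_ap[OF n, of j] by (auto simp: eventually_sequentially)
    define L where "L = max S (lev n + j)"
    have L: "S \<le> stage L" "lev n + j \<le> L" using stage_ge[of L] by (auto simp: L_def)
    have "M n - 2 / 2 ^ (lev n + j) \<le> avg (dyadic (ap (stage L))) j n" using L by (intro S)
    also have "\<dots> \<le> avg (avg (dyadic A) (Suc L - (lev n + j))) j n"
    proof (rule avg_mono)
      fix y assume y: "y \<in> leaves n j"
      show "dyadic (ap (stage L)) y \<le> avg (dyadic A) (Suc L - (lev n + j)) y"
        using le_avg_A[OF leaves_pos[OF y n], of L] lev_leaves[OF y n] L by (simp add: dyadic_def)
    qed
    also have "\<dots> = avg (dyadic A) (j + (Suc L - (lev n + j))) n" by (simp only: avg_add)
    also have "\<dots> \<le> mlim (dyadic A) n" using submart_A n by (rule avg_le_mlim)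
    finally show ?thesis .
  qed
  moreover have "(\<lambda>j. M n - 2 / 2 ^ (lev n + j)) \<longlonglongrightarrow> M n - 0"
    unfolding power_add divide_divide_eq_left[symmetric]
    by (intro tendsto_diff tendsto_const LIMSEQ_divide_realpow_zero) simp
  ultimately show "M n \<le> mlim (dyadic A) n"
    by (intro LIMSEQ_le_const2[of _ "M n"]) auto
qed

end

text \<open>The code of a string has a leading digit 1, so \<open>n / 2 ^ lev n\<close> is 1 plus
  the left endpoint of its dyadic interval.\<close>

definition slope :: "(real \<Rightarrow> real) \<Rightarrow> nat \<Rightarrow> real" where
  "slope f n = (f (real (n + 1) / 2 ^ lev n - 1) - f (real n / 2 ^ lev n - 1)) * 2 ^ lev n"

text \<open>Even numbers code the nonnegative integers.\<close>

lemma rat_of_code_frac: "rat_of_code (prod_encode (2 * u, 2 * w)) = real u / real w"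
  by (cases "w = 0") (simp_all add: rat_of_code_def nat_to_rat_surj_def int_decode_cases of_rat_rat rat_number_collapse)

lemma dyadic_interval:
  assumes "1 \<le> n"
  shows "0 \<le> real n / 2 ^ lev n - 1" "real n / 2 ^ lev n - 1 < real (n + 1) / 2 ^ lev n - 1"
    "real (n + 1) / 2 ^ lev n - 1 \<le> 1"
proof -
  have "real (2 ^ lev n) \<le> real n" using lev_le[OF assms] by (simp only: of_nat_le_iff)
  then show "0 \<le> real n / 2 ^ lev n - 1" by (simp add: le_divide_eq)
  have "real (n + 1) \<le> real (2 ^ Suc (lev n))" using less_lev[of n] by (simp only: of_nat_le_iff)
  then show "real (n + 1) / 2 ^ lev n - 1 \<le> 1" by (simp add: divide_le_eq)
qed (simp add: divide_strict_right_mono)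

lemma interval_ce_approx:
  assumes "interval_ce f"
  obtains A where "total_recursive 1 (\<lambda>xs. A (xs ! 0))" "submart (dyadic A)"
    "\<And>n. 1 \<le> n \<Longrightarrow> mlim (dyadic A) n = slope f n"
proof -
  let ?E = "{prod_encode (n, k) | n k. \<exists>i. codes_unit_rat_pair n i \<and> rat_of_code k < (case i of (x, y) \<Rightarrow> f y - f x)}"
  have mono: "mono_on {0..1} f" and ce: "ce ?E"
    using assms by (auto simp: interval_ce_def uniformly_left_ce_def)
  obtain R where R: "decidable 2 (\<lambda>xs. R (xs ! 0) (xs ! 1))" "\<And>x. x \<in> ?E \<longleftrightarrow> (\<exists>t. R x t)"
    by (rule ce_imp_decidable[OF ce], rule that)
  let ?rc = "\<lambda>u w. prod_encode (2 * u, 2 * w)"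
  \<comment> \<open>The code of the question whether the increment of \<open>f\<close> over the
    interval of \<open>n\<close> exceeds \<open>(m + 1) / 4 ^ lev n\<close>: one factor
    \<open>2 ^ lev n\<close> is the precision required of the slope, the other turns the increment
    into the slope. The subtractions are exact since \<open>2 ^ lev n \<le> n\<close>.\<close>
  define e where "e n m = prod_encode (prod_encode (?rc (n - 2 ^ lev n) (2 ^ lev n), ?rc (n + 1 - 2 ^ lev n) (2 ^ lev n)),
      ?rc (m + 1) (4 ^ lev n))" for n m
  interpret left_ce_approx "slope f" "\<lambda>n m t. R (e n m) t"
  proof
    fix n :: nat assume n: "1 \<le> n"
    note d = dyadic_interval[OF n]
    have "f x \<le> f y" if "0 \<le> x" "x < y" "y \<le> 1" for x y
      using that by (intro mono_onD[OF mono]) auto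
    from this[OF d] show "0 \<le> slope f n" by (simp add: slope_def)
    have "lev (2 * n) = Suc (lev n)" "lev (2 * n + 1) = Suc (lev n)"
      using lev_double[OF n, of False] lev_double[OF n, of True] by simp_all
    moreover have "real (2 * n) / 2 ^ Suc l = real n / 2 ^ l" "real (2 * n + 1 + 1) / 2 ^ Suc l = real (n + 1) / 2 ^ l" for l
      by (simp_all add: field_simps)
    ultimately show "slope f n = (slope f (2 * n) + slope f (2 * n + 1)) / 2"
      by (simp add: slope_def algebra_simps)
  next
    note R' = rec_comp2[where F = "\<lambda>x y. of_bool (R x y)", OF R(1)]
    show "decidable 3 (\<lambda>xs. R (e (xs ! 0) (xs ! 1)) (xs ! 2))"
      unfolding e_def by (intro R' rec_intros) auto
  next
    fix n m :: nat assume n: "1 \<le> n"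
    let ?x = "real n / 2 ^ lev n - 1" and ?y = "real (n + 1) / 2 ^ lev n - 1"
    have "rat_of_code (?rc (n - 2 ^ lev n) (2 ^ lev n)) = ?x"
      "rat_of_code (?rc (n + 1 - 2 ^ lev n) (2 ^ lev n)) = ?y"
      using lev_le[OF n] by (simp_all add: rat_of_code_frac of_nat_diff diff_divide_distrib)
    moreover have "rat_of_code (?rc (m + 1) (4 ^ lev n)) = real (m + 1) / 4 ^ lev n"
      by (simp only: rat_of_code_frac of_nat_power of_nat_numeral)
    ultimately have "e n m \<in> ?E \<longleftrightarrow> real (m + 1) / 4 ^ lev n < f ?y - f ?x"
      using dyadic_interval[OF n] by (auto simp: e_def codes_unit_rat_pair_def)
    also have "(4::real) ^ lev n = 2 ^ lev n * 2 ^ lev n"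
      by (simp flip: power_mult_distrib)
    also have "real (m + 1) / (2 ^ lev n * 2 ^ lev n) < f ?y - f ?x \<longleftrightarrow> real (m + 1) / 2 ^ lev n < slope f n"
      by (simp add: slope_def divide_less_eq mult.assoc)
    finally show "(\<exists>t. R (e n m) t) \<longleftrightarrow> real (m + 1) / 2 ^ lev n < slope f n"
      using R(2) by blast
  qed
  show ?thesis using that[OF rec_A submart_A mlim_A] .
qed

section \<open>Derivative from dyadic slopes\<close>

lemma binary_expansion_path_code:
  assumes "binary_expansion Z z"
  shows "real (path_code Z n) \<le> (z + 1) * 2 ^ n" "(z + 1) * 2 ^ n \<le> real (path_code Z n + 1)"
proof -
  let ?b = "\<lambda>i. of_bool (Z i) / 2 ^ Suc i :: real"
  have S: "(\<Sum>i<n. ?b i) = real (path_code Z n) / 2 ^ n - 1"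
    by (induction n) (simp_all add: path_code_Suc field_simps)
  have tail: "(\<lambda>i. ?b (i + n)) sums (z - (\<Sum>i<n. ?b i))"
    using assms unfolding binary_expansion_def by (rule sums_split_initial_segment)
  then have "0 \<le> z - (\<Sum>i<n. ?b i)"
    by (rule sums_le[OF _ sums_zero, rotated]) simp
  moreover have "z - (\<Sum>i<n. ?b i) \<le> 1 / 2 ^ n"
  proof (rule sums_le[OF _ tail])
    show "(\<lambda>i. 1 / 2 ^ n * (1 / 2) ^ Suc i :: real) sums (1 / 2 ^ n)"
      using sums_mult[OF power_half_series, of "1 / 2 ^ n"] by simp
    show "?b (i + n) \<le> 1 / 2 ^ n * (1 / 2) ^ Suc i" for i
      by (simp add: power_add power_divide mult_ac)
  qed
  ultimately have "real (path_code Z n) / 2 ^ n \<le> z + 1" "z + 1 \<le> real (path_code Z n + 1) / 2 ^ n"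
    unfolding S by (simp_all add: add_divide_distrib)
  then show "real (path_code Z n) \<le> (z + 1) * 2 ^ n" "(z + 1) * 2 ^ n \<le> real (path_code Z n + 1)"
    by (simp_all only: pos_divide_le_eq pos_le_divide_eq zero_less_power zero_less_numeral)
qed

text \<open>An irrational \<open>z\<close> is no dyadic point, so each of its dyadic intervals
  contains a neighbourhood of \<open>z\<close>.\<close>

lemma irrational_path_code_less:
  assumes "binary_expansion Z z" "z \<notin> \<rat>"
  shows "real (path_code Z n) < (z + 1) * 2 ^ n" "(z + 1) * 2 ^ n < real (path_code Z n + 1)"
proof -
  have "(z + 1) * 2 ^ n \<noteq> real i" for i
  proof
    assume "(z + 1) * 2 ^ n = real i"
    then have "z = real i / 2 ^ n - 1" by (simp add: field_simps)
    then show False using assms(2) by (simp add: Rats_divide Rats_diff)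
  qed
  then show "real (path_code Z n) < (z + 1) * 2 ^ n" "(z + 1) * 2 ^ n < real (path_code Z n + 1)"
    using binary_expansion_path_code[OF assms(1), of n] by (simp_all only: less_le) metis+
qed

lemma ex_dyadic_scale:
  fixes h c :: real
  assumes "0 < h" "h < c / 2 ^ k"
  obtains m where "k < m" "c / 2 ^ m \<le> h" "h < 2 * (c / 2 ^ m)"
proof -
  obtain i where i: "c / h < 2 ^ i" using real_arch_pow[of 2 "c / h"] by auto
  define R where "R m \<longleftrightarrow> c / 2 ^ m \<le> h" for m
  have "R i" using i assms(1) by (simp add: R_def field_simps)
  define m where "m = (LEAST m. R m)"
  have m: "R m" unfolding m_def using \<open>R i\<close> by (rule LeastI)
  have "k < m"
  proof (rule ccontr)
    assume "\<not> k < m"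
    then have "c / 2 ^ k \<le> c / 2 ^ m"
      using assms by (intro divide_left_mono power_increasing) (auto simp: zero_less_divide_iff dest: less_trans)
    with m assms(2) show False by (simp add: R_def)
  qed
  then obtain j where j: "m = Suc j" by (metis less_imp_Suc_add)
  have "\<not> R j" unfolding m_def by (rule not_less_Least) (use j in \<open>simp add: m_def\<close>)
  with m \<open>k < m\<close> show ?thesis
    by (intro that[of m]) (auto simp: R_def j)
qed

text \<open>By monotonicity \<open>f y - f x\<close> lies between the increments over the cells
  strictly between those of \<open>x\<close> and \<open>y\<close> and over all cells including these
  two. Either way the total length differs from \<open>y - x\<close> by at most two cells.\<close>

lemma slope_between:
  fixes f :: "real \<Rightarrow> real" and m :: nat
  assumes mono: "mono_on {0..1} f" and xy: "0 \<le> x" "x < y"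
    and i: "real i0 \<le> (x + 1) * 2 ^ m" "(x + 1) * 2 ^ m < real (i0 + 1)"
           "real i1 \<le> (y + 1) * 2 ^ m" "(y + 1) * 2 ^ m < real (i1 + 1)"
    and range: "2 ^ m \<le> i0" "i1 < 2 ^ Suc m" "i0 < i1"
    and slopes: "\<And>i. i0 \<le> i \<Longrightarrow> i \<le> i1 \<Longrightarrow> q \<le> slope f i \<and> slope f i \<le> p"
    and p: "0 \<le> p" and q: "0 \<le> q"
  shows "f y - f x \<le> p * (y - x + 2 / 2 ^ m)" "q * (y - x - 2 / 2 ^ m) \<le> f y - f x"
proof -
  define g where "g i = f (real i / 2 ^ m - 1)" for i
  have lev: "lev i = m" if "i0 \<le> i" "i \<le> i1" for i
    using that range by (intro lev_eqI) auto
  have slope: "g (Suc i) - g i = slope f i / 2 ^ m" if "i0 \<le> i" "i \<le> i1" for i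
    by (simp add: g_def slope_def lev[OF that] add.commute)
  have bounds: "q / 2 ^ m \<le> g (Suc i) - g i" "g (Suc i) - g i \<le> p / 2 ^ m" if "i0 \<le> i" "i \<le> i1" for i
    using slopes[OF that] by (simp_all add: slope[OF that] divide_right_mono)
  have I: "real i / 2 ^ m - 1 \<in> {0..1}" if "i0 \<le> i" "i \<le> Suc i1" for i
  proof -
    have "(2::nat) ^ m \<le> i" "i \<le> 2 * 2 ^ m" using that range by auto
    then have "real (2 ^ m) \<le> real i" "real i \<le> real (2 * 2 ^ m)" by (simp_all only: of_nat_le_iff)
    then show ?thesis by (simp add: le_divide_eq divide_le_eq)
  qed
  have div: "real i0 / 2 ^ m - 1 \<le> x" "x \<le> real (Suc i0) / 2 ^ m - 1"
     "real i1 / 2 ^ m - 1 \<le> y" "y \<le> real (Suc i1) / 2 ^ m - 1"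
    using i by (simp_all add: field_simps)
  have "y \<le> 1" using div(4) I[of "Suc i1"] range by simp
  then have unit: "x \<in> {0..1}" "y \<in> {0..1}" using xy by auto
  have fx: "g i0 \<le> f x" "f x \<le> g (Suc i0)" and fy: "g i1 \<le> f y" "f y \<le> g (Suc i1)"
    unfolding g_def
    by (rule mono_onD[OF mono I unit(1) div(1)] mono_onD[OF mono unit(1) I div(2)]
        mono_onD[OF mono I unit(2) div(3)] mono_onD[OF mono unit(2) I div(4)]; use range in simp)+
  have width: "(y - x) * 2 ^ m - 2 \<le> real (i1 - Suc i0)" "real (Suc i1 - i0) \<le> (y - x) * 2 ^ m + 2"
    using i range by (simp_all add: of_nat_diff algebra_simps)
  have scale: "((y - x) * 2 ^ m + c) / 2 ^ m = y - x + c / 2 ^ m" for c :: real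
    by (simp add: add_divide_distrib)
  have "f y - f x \<le> g (Suc i1) - g i0" using fx fy by simp
  also have "\<dots> = (\<Sum>i=i0..<Suc i1. g (Suc i) - g i)"
    using range by (subst sum_Suc_diff') auto
  also have "\<dots> \<le> (\<Sum>i=i0..<Suc i1. p / 2 ^ m)"
    by (intro sum_mono bounds) auto
  also have "\<dots> = p * (real (Suc i1 - i0) / 2 ^ m)" by simp
  also have "\<dots> \<le> p * (((y - x) * 2 ^ m + 2) / 2 ^ m)"
    using width(2) p by (intro mult_left_mono divide_right_mono) auto
  finally show "f y - f x \<le> p * (y - x + 2 / 2 ^ m)" unfolding scale .
  have "q * (((y - x) * 2 ^ m + - 2) / 2 ^ m) \<le> q * (real (i1 - Suc i0) / 2 ^ m)"
    using width(1) q by (intro mult_left_mono divide_right_mono) auto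
  also have "\<dots> = (\<Sum>i=Suc i0..<i1. q / 2 ^ m)" by simp
  also have "\<dots> \<le> (\<Sum>i=Suc i0..<i1. g (Suc i) - g i)"
    by (intro sum_mono bounds) auto
  also have "\<dots> = g i1 - g (Suc i0)"
    using range by (subst sum_Suc_diff') auto
  also have "\<dots> \<le> f y - f x" using fx fy by simp
  finally show "q * (y - x - 2 / 2 ^ m) \<le> f y - f x" unfolding scale by simp
qed

theorem theorem10p17:
  fixes f :: "real \<Rightarrow> real" and z :: real
  assumes "interval_ce f"
    and "ce_martingale_convergence_point z"
  shows "\<exists>D. (f has_real_derivative D) (at z within {0..1})"
proof -
  from assms(2) obtain Z where z: "0 \<le> z" "z \<le> 1" "z \<notin> \<rat>" and bin: "binary_expansion Z z"
    and conv: "\<And>M. left_ce_martingale M \<Longrightarrow> convergent (\<lambda>n. M (map Z [0..<n]))"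
    by (auto simp: ce_martingale_convergence_point_def)
  let ?p = "path_code Z"
  have path: "convergence_path Z" using conv by (rule convergence_pathI)
  have mono: "mono_on {0..1} f" using assms(1) by (simp add: interval_ce_def)
  obtain A where A: "total_recursive 1 (\<lambda>xs. A (xs ! 0))" "submart (dyadic A)"
    and slope: "\<And>n. 1 \<le> n \<Longrightarrow> mlim (dyadic A) n = slope f n"
    by (rule interval_ce_approx[OF assms(1)], rule that)
  obtain v where v: "(\<lambda>n. mlim (dyadic A) (?p n)) \<longlonglongrightarrow> v"
    using convergence_pathD[OF path A] by (auto simp: convergent_def)
  have "0 \<le> v"
    using v by (rule LIMSEQ_le_const) (auto intro: mlim_nonneg A path_code_pos)
  note less = irrational_path_code_less[OF bin z(3)]
  have "((\<lambda>y. (f y - f z) / (y - z)) \<longlongrightarrow> v) (at z within {0..1})"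
  proof (rule ccontr)
    assume "\<not> ?thesis"
    then obtain e where e: "0 < e" and not_close: "\<not> (\<exists>d>0. \<forall>y\<in>{0..1}. 0 < dist y z \<and> dist y z < d \<longrightarrow>
        dist ((f y - f z) / (y - z)) v < e)"
      unfolding Lim_within by blast
    have far: "\<exists>y\<in>{0..1}. y \<noteq> z \<and> \<bar>y - z\<bar> < d \<and> e \<le> \<bar>(f y - f z) / (y - z) - v\<bar>" if "0 < d" for d
      using not_close that unfolding dist_real_def by (metis abs_0 diff_self less_irrefl not_less)
    define p q where "p = v + e / 2" and "q = v - e / 2"
    \<comment> \<open>The scale \<open>m\<close> will satisfy
      \<open>N \<le> (b - a) * 2 ^ m < 2 * N\<close>. By \<open>4 * p / e < N\<close> the two
      boundary cells in \<open>slope_between\<close> change the difference quotient by less than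
      \<open>e / 2\<close>; \<open>2 < N\<close> puts the endpoints into different cells; the upper
      bound leads to the neighbourhood size \<open>2 * N + 1\<close>.\<close>
    obtain N :: nat where N: "max 2 (4 * p / e) < real N" using reals_Archimedean2 by blast
    show False
    proof (rule no_deviation[OF A path v, where ?p0.0 = p and ?q0.0 = q and K = "2 * N + 1"])
      show "v < p" "q < v \<or> q \<le> 0" using e by (auto simp: p_def q_def)
    next
      fix n m0
      define l r where "l = real (?p n) / 2 ^ n - 1" and "r = real (?p n + 1) / 2 ^ n - 1"
      have lr: "l < z" "z < r" using less[of n] by (simp_all add: l_def r_def field_simps)
      \<comment> \<open>The first part keeps \<open>y\<close> inside the dyadic interval of
        \<open>?p n\<close>, so that all cells between \<open>y\<close> and \<open>z\<close> lie
        below this node; the last term forces \<open>m\<close> above \<open>m0\<close> and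
        \<open>n\<close>.\<close>
      define d where "d = min (min (z - l) (r - z)) (real N / 2 ^ max m0 n)"
      have "0 < d" using lr N by (simp add: d_def)
      then obtain y where y: "y \<in> {0..1}" "y \<noteq> z" "\<bar>y - z\<bar> < d" "e \<le> \<bar>(f y - f z) / (y - z) - v\<bar>"
        using far by blast
      obtain m where m: "max m0 n < m" "real N / 2 ^ m \<le> \<bar>y - z\<bar>" "\<bar>y - z\<bar> < 2 * (real N / 2 ^ m)"
        using ex_dyadic_scale[of "\<bar>y - z\<bar>" "real N" "max m0 n"] y by (auto simp: d_def)
      define k where "k = m - n"
      have k: "m = n + k" using m(1) by (simp add: k_def)
      define idx where "idx x = nat \<lfloor>(x + 1) * 2 ^ m\<rfloor>" for x :: real
      have idx: "real (idx x) \<le> (x + 1) * 2 ^ m" "(x + 1) * 2 ^ m < real (idx x + 1)" if "0 \<le> x" for x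
      proof -
        have "0 \<le> (x + 1) * 2 ^ m" using that by simp
        then show "real (idx x) \<le> (x + 1) * 2 ^ m" "(x + 1) * 2 ^ m < real (idx x + 1)"
          unfolding idx_def by linarith+
      qed
      have idx_leaves: "idx x \<in> leaves (?p n) k" if "0 \<le> x" "l < x" "x < r" for x
      proof -
        have "real (?p n * 2 ^ k) < (x + 1) * 2 ^ m" "(x + 1) * 2 ^ m < real ((?p n + 1) * 2 ^ k)"
        proof -
          have "real (?p n) < (x + 1) * 2 ^ n" "(x + 1) * 2 ^ n < real (?p n + 1)"
            using that(2,3) by (simp_all add: l_def r_def field_simps)
          then have "real (?p n) * 2 ^ k < (x + 1) * 2 ^ n * 2 ^ k" "(x + 1) * 2 ^ n * 2 ^ k < real (?p n + 1) * 2 ^ k"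
            by (simp_all only: mult_less_cancel_right_pos zero_less_power zero_less_numeral)
          then show "real (?p n * 2 ^ k) < (x + 1) * 2 ^ m" "(x + 1) * 2 ^ m < real ((?p n + 1) * 2 ^ k)"
            unfolding k power_add mult.assoc of_nat_mult of_nat_power of_nat_numeral .
        qed
        with idx[OF that(1)] have "real (?p n * 2 ^ k) < real (idx x + 1)" "real (idx x) < real ((?p n + 1) * 2 ^ k)"
          by linarith+
        then show ?thesis by (simp only: of_nat_less_iff) (simp add: leaves_altdef)
      qed
      have idx_z: "idx z = ?p m"
        using less[of m] unfolding idx_def by linarith
      define a b where "a = min z y" and "b = max z y"
      have ab: "0 \<le> a" "a < b" "b - a = \<bar>y - z\<bar>" "l < a" "b < r" "0 \<le> b"
        using z y lr by (auto simp: a_def b_def d_def min_def max_def abs_if split: if_splits)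
      have quot: "(f y - f z) / (y - z) = (f b - f a) / (b - a)"
      proof (cases "z \<le> y")
        case True then show ?thesis by (simp add: a_def b_def)
      next
        case False
        then show ?thesis by (simp add: a_def b_def minus_divide_divide[of "f z - f y" "z - y", symmetric])
      qed
      have leaves: "idx a \<in> leaves (?p n) k" "idx b \<in> leaves (?p n) k"
        using ab by (auto intro!: idx_leaves)
      have between: "J \<in> leaves (?p n) k" if "idx a \<le> J" "J \<le> idx b" for J
        using leaves that by (auto simp: leaves_altdef)
      have lev: "lev (idx a) = m" "lev (idx b) = m"
        using lev_leaves[OF leaves(1) path_code_pos] lev_leaves[OF leaves(2) path_code_pos]
        by (simp_all add: lev_path_code k)
      have idx_range: "2 ^ m \<le> idx a" "idx b < 2 ^ Suc m"
        using lev_le[OF leaves_pos[OF leaves(1) path_code_pos]] less_lev[of "idx b"] lev by simp_all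
      have N2: "2 < real N" using N by simp
      have scaled: "real N \<le> (b - a) * 2 ^ m" "(b - a) * 2 ^ m < 2 * real N"
        using m ab by (simp_all add: field_simps)
      have "real (idx a) + 1 < real (idx b) + 1"
        using idx(1)[OF ab(1)] idx(2)[OF ab(6)] scaled(1) N2 by (simp add: algebra_simps)
      then have idx_less: "idx a < idx b" by simp
      have "real (idx b) < real (idx a) + real (2 * N + 1)"
        using idx(2)[OF ab(1)] idx(1)[OF ab(6)] scaled(2) by (simp add: algebra_simps)
      then have idx_near: "idx b \<le> idx a + (2 * N + 1)" by linarith
      have "\<exists>J. idx a \<le> J \<and> J \<le> idx b \<and> (p < slope f J \<or> slope f J < q)"
      proof (rule ccontr)
        assume "\<not> ?thesis"
        \<comment> \<open>The lower bound in \<open>slope_between\<close> must be nonnegative.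
          Slopes are, so \<open>q\<close> may be replaced by \<open>max q 0\<close>.\<close>
        then have slopes: "max q 0 \<le> slope f J \<and> slope f J \<le> p" if "idx a \<le> J" "J \<le> idx b" for J
          using that slope[OF leaves_pos[OF between[OF that] path_code_pos]]
            mlim_nonneg[OF A(2) leaves_pos[OF between[OF that] path_code_pos]]
          by (auto simp: not_less)
        have p0: "0 \<le> p" using \<open>0 \<le> v\<close> e by (simp add: p_def)
        note sb = slope_between[OF mono ab(1,2) idx[OF ab(1)] idx[OF ab(6)] idx_range idx_less slopes p0 max.cobounded2]
        define t where "t = 2 / (2 ^ m :: real)"
        have t: "0 \<le> t" "t * (2 * p) < e * (b - a)"
        proof -
          have "t * real N \<le> 2 * (b - a)" using scaled(1) by (simp add: t_def field_simps)
          moreover have "4 * p < e * real N" using N e by (simp add: divide_less_eq mult.commute)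
          moreover have "0 < t" by (simp add: t_def)
          ultimately have "t * (4 * p) < t * (e * real N)" "e * (t * real N) \<le> e * (2 * (b - a))"
            using e by simp_all
          then show "t * (2 * p) < e * (b - a)" by (simp add: algebra_simps)
        qed (simp add: t_def)
        have "e * (b - a) \<le> \<bar>f b - f a - v * (b - a)\<bar>"
          using y(4) ab(2) unfolding quot by (simp add: field_simps abs_if split: if_splits)
        then consider "(v + e) * (b - a) \<le> f b - f a" | "f b - f a \<le> (v - e) * (b - a)"
          by (auto simp: algebra_simps abs_if split: if_splits)
        then show False
        proof cases
          case 1
          have "f b - f a \<le> p * (b - a + t)" using sb(1) by (simp add: t_def)
          also have "\<dots> = p * (b - a) + t * (2 * p) / 2" by (simp add: distrib_left)
          also have "\<dots> < p * (b - a) + e * (b - a) / 2" using t(2) by simp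
          also have "\<dots> = (v + e) * (b - a)" by (simp add: p_def field_simps)
          finally show False using 1 by simp
        next
          case 2
          have "max q 0 * (b - a - t) \<le> f b - f a" using sb(2) by (simp add: t_def)
          moreover have "(v - e) * (b - a) < max q 0 * (b - a - t)"
          proof (cases "0 \<le> q")
            case True
            have "t * q \<le> t * p" using t(1) e by (intro mult_left_mono) (auto simp: p_def q_def)
            have "(v - e) * (b - a) = q * (b - a) - e * (b - a) / 2" by (simp add: q_def field_simps)
            also have "\<dots> < q * (b - a) - t * (2 * p) / 2" using t(2) by simp
            also have "\<dots> \<le> q * (b - a - t)"
              using \<open>t * q \<le> t * p\<close> by (simp add: right_diff_distrib mult.commute)
            finally show ?thesis using True by simp
          next
            case False
            have "(v - e) * (b - a) < 0"
              using False e ab(2) by (intro mult_neg_pos) (auto simp: q_def)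
            then show ?thesis using False by simp
          qed
          ultimately show False using 2 by simp
        qed
      qed
      then obtain J where J: "idx a \<le> J" "J \<le> idx b" "p < slope f J \<or> slope f J < q" by blast
      have Jl: "J \<in> leaves (?p n) (m - n)" using between[OF J(1,2)] by (simp add: k_def)
      have "?p m = idx a \<or> ?p m = idx b"
        using idx_z by (auto simp: a_def b_def min_def max_def)
      then have "J \<le> ?p m + (2 * N + 1)" "?p m \<le> J + (2 * N + 1)"
        using J(1,2) idx_near by auto
      then show "\<exists>m\<ge>m0. n \<le> m \<and> (\<exists>J\<in>leaves (?p n) (m - n). J \<le> ?p m + (2 * N + 1) \<and>
          ?p m \<le> J + (2 * N + 1) \<and> (p < mlim (dyadic A) J \<or> mlim (dyadic A) J < q))"
        using m(1) Jl J(3) slope[OF leaves_pos[OF Jl path_code_pos]]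
        by (intro exI[of _ m] conjI bexI[of _ J]) auto
    qed
  qed
  then show ?thesis by (auto simp: has_field_derivative_iff)
qed

end
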